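(* Let $M:\mathbb{U}\to\mathbb{C}$ be a mixed unitary category. Then $\mathsf{CP}^\infty(M:\mathbb{U}\to\mathbb{C})$ is a category.
   Context: Composition is written in diagrammatic order, $f;g$ meaning first $f$ then $g$. LDC: a linearly distributive category (Cockett–Seely) has two monoidal structures, tensor $(\otimes,\top,a_\otimes,u_\otimes^L,u_\otimes^R)$ and par $(\oplus,\bot,a_\oplus,u_\oplus^L,u_\oplus^R)$, with associators oriented as $X(YZ)\to(XY)Z$ and unitors oriented towards the object, linked by natural transformations $\partial^L:A\otimes(B\oplus C)\to(A\otimes B)\oplus C$ and $\partial^R:(A\oplus B)\otimes C\to A\oplus(B\otimes C)$ satisfying the usual Cockett–Seely coherence conditions. An isomix category is an LDC with an isomorphism $\mathsf{m}:\bot\to\top$; then $\mathrm{mx}_{A,B}:A\otimes B\to A\oplus B$ is the natural map $(1\otimes(u_\oplus^L)^{-1});(1\otimes(\mathsf{m}\oplus1));\partial^L;(u_\otimes^R\oplus1)$. The core consists of the objects $U$ such that $\mathrm{mx}_{U,X}$ and $\mathrm{mx}_{X,U}$ are isomorphisms for all $X$. $\dagger$-LDC: an LDC with a functor $(\_)^\dagger:\mathbb{X}^{\mathrm{op}}\to\mathbb{X}$ and natural isomorphisms $\lambda_\otimes:A^\dagger\otimes B^\dagger\to(A\oplus B)^\dagger$, $\lambda_\oplus:A^\dagger\oplus B^\dagger\to(A\otimes B)^\dagger$, $\lambda_\top:\top\to\bot^\dagger$, $\lambda_\bot:\bot\to\top^\dagger$, $\iota:A\to A^{\dagger\dagger}$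 such that: (1) $a_\otimes;(\lambda_\otimes\otimes 1);\lambda_\otimes=(1\otimes\lambda_\otimes);\lambda_\otimes;(a_\oplus^{-1})^\dagger$ and the same with $\otimes,\oplus$ exchanged; (2) $(\lambda_\top\otimes1);\lambda_\otimes=u_\otimes^L;(u_\oplus^L)^\dagger$, $(\lambda_\bot\oplus1);\lambda_\oplus=u_\oplus^L;(u_\otimes^L)^\dagger$ and the right-handed versions; (3) $\partial^L;(\lambda_\otimes\oplus1);\lambda_\oplus=(1\otimes\lambda_\oplus);\lambda_\otimes;(\partial^R)^\dagger$ and $\partial^R;(1\oplus\lambda_\otimes);\lambda_\oplus=(\lambda_\oplus\otimes1);\lambda_\otimes;(\partial^L)^\dagger$; (4) $\iota_{A\oplus B};\lambda_\otimes^\dagger=(\iota_A\oplus\iota_B);\lambda_\oplus$ and $\iota_{A\otimes B};\lambda_\oplus^\dagger=(\iota_A\otimes\iota_B);\lambda_\otimes$; (5) $\iota_\bot;\lambda_\top^\dagger=\lambda_\bot$ and $\iota_\top;\lambda_\bot^\dagger=\lambda_\top$; (6) $\iota_{A^\dagger}=(\iota_A^{-1})^\dagger$. A $\dagger$-isomix category is a $\dagger$-LDC that is isomix with $\mathsf{m};\lambda_\top=\lambda_\bot;\mathsf{m}^\dagger$. Unitary category: a $\dagger$-isomix category $\mathbb{U}$ in which every object $A$ lies in the core and is equipped with an isomorphism $\varphi_A:A\to A^\dagger$ such that $\varphi_{A^\dagger}=(\varphi_A^{-1})^\dagger$; $\varphi_A;\varphi_{A^\dagger}=\iota_A$; $\varphi_\bot;\lambda_\top^{-1}=\mathsf{m}=\lambda_\bot;\varphi_\top^{-1}$;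 $(\varphi_A\otimes\varphi_B);\lambda_\otimes;\varphi_{A\oplus B}^{-1}=\mathrm{mx}_{A,B}=\varphi_{A\otimes B};\lambda_\oplus^{-1};(\varphi_A^{-1}\oplus\varphi_B^{-1})$. Isomix functor $F$ between isomix categories: a functor that is monoidal for $\otimes$ ($m_\otimes:F(A)\otimes F(B)\to F(A\otimes B)$, $m_\top:\top\to F(\top)$) and comonoidal for $\oplus$ ($n_\oplus:F(A\oplus B)\to F(A)\oplus F(B)$, $n_\bot:F(\bot)\to\bot$), satisfying the Frobenius conditions $m_\otimes;F(\partial^L);n_\oplus=(1\otimes n_\oplus);\partial^L;(m_\otimes\oplus1)$ and $m_\otimes;F(\partial^R);n_\oplus=(n_\oplus\otimes1);\partial^R;(1\oplus m_\otimes)$, with $F(\mathsf{m})=n_\bot;\mathsf{m};m_\top$ and $\mathsf{m}^{-1}=m_\top;F(\mathsf{m}^{-1});n_\bot$. It is strong if $m_\otimes,m_\top,n_\oplus,n_\bot$ are isomorphisms. A $\dagger$-isomix functor between $\dagger$-isomix categories is an isomix functor with a natural isomorphism $\rho_A:F(A^\dagger)\to F(A)^\dagger$ (the preservator) such that $m_\otimes;F(\lambda_\otimes);\rho=(\rho\otimes\rho);\lambda_\otimes;n_\oplus^\dagger$, $m_\top;F(\lambda_\top);\rho=\lambda_\top;n_\bot^\dagger$, $F(\lambda_\oplus);\rho;m_\otimes^\dagger=n_\oplus;(\rho\oplus\rho);\lambda_\oplus$, $F(\lambda_\bot);\rho;m_\top^\dagger=n_\bot;\lambda_\bot$, and $\iota_{F(X)};(\rho_X)^\dagger=F(\iota_X);\rho_{X^\dagger}$.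 Mixed unitary category (MUC) $M:\mathbb{U}\to\mathbb{C}$: a $\dagger$-isomix category $\mathbb{C}$ with a strong $\dagger$-isomix functor $M$ from a unitary category $\mathbb{U}$, such that $\mathrm{mx}_{M(U),X}$ and $\mathrm{mx}_{X,M(U)}$ are natural isomorphisms for all $U\in\mathbb{U}$, $X\in\mathbb{C}$. Kraus maps: a Kraus map $(f,U):A\to B$ is a map $f:A\to M(U)\oplus B$ in $\mathbb{C}$ with $U\in\mathbb{U}$. Kraus maps $(f,U),(g,V):A\to B$ are equivalent, $(f,U)\sim(g,V)$, if for all $C\in\mathbb{C}$, $W\in\mathbb{U}$ and all $h:B\otimes C\to M(W)$ in $\mathbb{C}$ one has $T_h(f,U)=T_h(g,V)$, where $T_h(f,U):A\otimes C\to(A\otimes C)^\dagger$ is $$(f\otimes1);\partial^R;(1\oplus h);\mathrm{mx}^{-1};(M(\varphi_U)\otimes M(\varphi_W));(\rho\otimes\rho);(1\otimes(h^\dagger;\lambda_\oplus^{-1}));\partial^L;(\lambda_\otimes\oplus1);(f^\dagger\oplus1);\lambda_\oplus,$$ passing through $(M(U)\oplus B)\otimes C$, $M(U)\oplus(B\otimes C)$, $M(U)\oplus M(W)$, $M(U)\otimes M(W)$, $M(U^\dagger)\otimes M(W^\dagger)$, $M(U)^\dagger\otimes M(W)^\dagger$, $M(U)^\dagger\otimes(B^\dagger\oplus C^\dagger)$, $(M(U)^\dagger\otimes B^\dagger)\oplus C^\dagger$, $(M(U)\oplus B)^\dagger\oplus C^\dagger$, $A^\dagger\oplus C^\dagger$.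 $\mathsf{CP}^\infty(M:\mathbb{U}\to\mathbb{C})$: objects are those of $\mathbb{C}$; maps $A\to B$ are $\sim$-classes $[(f,U)]$ of Kraus maps $(f,U):A\to B$; the composite of $[(f,U)]:A\to B$ and $[(g,V)]:B\to C$ is the class of $\big(f;(1\oplus g);a_\oplus;(n_\oplus^{-1}\oplus1),\,U\oplus V\big)$, where $a_\oplus:M(U)\oplus(M(V)\oplus C)\to(M(U)\oplus M(V))\oplus C$ and $n_\oplus^{-1}:M(U)\oplus M(V)\to M(U\oplus V)$; the identity on $A$ is the class of $\big((u_\oplus^L)^{-1};(n_\bot^{-1}\oplus1),\,\bot\big):A\to M(\bot)\oplus A$ (with $n_\oplus,n_\bot$ those of $M$). *)

theory Defs
  imports Main
begin

section \<open>Categories\<close>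

text \<open>
  Composition is written in diagrammatic order. All categories have explicit carriers for
  objects and arrows; the values of the operations off the carriers are irrelevant.
\<close>

record ('o, 'm) category =
  Ob :: "'o set"
  Arr :: "'m set"
  Dom :: "'m \<Rightarrow> 'o"
  Cod :: "'m \<Rightarrow> 'o"
  ide :: "'o \<Rightarrow> 'm" ("\<one>\<index>")
  cmp :: "'m \<Rightarrow> 'm \<Rightarrow> 'm" (infixl "\<Zsemi>\<index>" 55)

definition hom :: "('o, 'm, 'x) category_scheme \<Rightarrow> 'o \<Rightarrow> 'o \<Rightarrow> 'm set" where
  "hom C A B = {f \<in> Arr C. Dom C f = A \<and> Cod C f = B}"

locale category =
  fixes C :: "('o, 'm, 'x) category_scheme" (structure)
  assumes Dom_Ob: "f \<in> Arr C \<Longrightarrow> Dom C f \<in> Ob C"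
    and Cod_Ob: "f \<in> Arr C \<Longrightarrow> Cod C f \<in> Ob C"
    and ide_hom: "A \<in> Ob C \<Longrightarrow> \<one> A \<in> hom C A A"
    and cmp_hom: "\<lbrakk>f \<in> hom C A B; g \<in> hom C B D\<rbrakk> \<Longrightarrow> f \<Zsemi> g \<in> hom C A D"
    and ide_cmp: "f \<in> hom C A B \<Longrightarrow> \<one> A \<Zsemi> f = f"
    and cmp_ide: "f \<in> hom C A B \<Longrightarrow> f \<Zsemi> \<one> B = f"
    and cmp_assoc: "\<lbrakk>f \<in> hom C A B; g \<in> hom C B D; h \<in> hom C D E\<rbrakk>
      \<Longrightarrow> (f \<Zsemi> g) \<Zsemi> h = f \<Zsemi> (g \<Zsemi> h)"

definition inverse_arrows :: "('o, 'm, 'x) category_scheme \<Rightarrow> 'm \<Rightarrow> 'm \<Rightarrow> bool" where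
  "inverse_arrows C f g \<longleftrightarrow>
     g \<in> hom C (Cod C f) (Dom C f) \<and>
     f \<Zsemi>\<^bsub>C\<^esub> g = \<one>\<^bsub>C\<^esub> (Dom C f) \<and> g \<Zsemi>\<^bsub>C\<^esub> f = \<one>\<^bsub>C\<^esub> (Cod C f)"

definition iso :: "('o, 'm, 'x) category_scheme \<Rightarrow> 'o \<Rightarrow> 'o \<Rightarrow> 'm set" where
  "iso C A B = {f \<in> hom C A B. \<exists>g. inverse_arrows C f g}"

definition inv_arrow :: "('o, 'm, 'x) category_scheme \<Rightarrow> 'm \<Rightarrow> 'm"
    ("_\<^sup>-\<^sup>1\<index>" [999] 999) where
  "inv_arrow C f = (THE g. inverse_arrows C f g)"

section \<open>Monoidal structures\<close>

locale monoidal = category C for C :: "('o, 'm, 'x) category_scheme" (structure) +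
  fixes tob :: "'o \<Rightarrow> 'o \<Rightarrow> 'o" (infixr "\<odot>\<^sub>o" 70)
    and tar :: "'m \<Rightarrow> 'm \<Rightarrow> 'm" (infixr "\<odot>" 70)
    and I :: 'o
    and a :: "'o \<Rightarrow> 'o \<Rightarrow> 'o \<Rightarrow> 'm"
    and uL uR :: "'o \<Rightarrow> 'm"
  assumes tob_Ob: "\<lbrakk>A \<in> Ob C; B \<in> Ob C\<rbrakk> \<Longrightarrow> A \<odot>\<^sub>o B \<in> Ob C"
    and tar_hom: "\<lbrakk>f \<in> hom C A A'; g \<in> hom C B B'\<rbrakk> \<Longrightarrow> f \<odot> g \<in> hom C (A \<odot>\<^sub>o B) (A' \<odot>\<^sub>o B')"
    and tar_ide: "\<lbrakk>A \<in> Ob C; B \<in> Ob C\<rbrakk> \<Longrightarrow> \<one> A \<odot> \<one> B = \<one> (A \<odot>\<^sub>o B)"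
    and tar_cmp: "\<lbrakk>f \<in> hom C A A'; f' \<in> hom C A' A''; g \<in> hom C B B'; g' \<in> hom C B' B''\<rbrakk>
      \<Longrightarrow> (f \<Zsemi> f') \<odot> (g \<Zsemi> g') = (f \<odot> g) \<Zsemi> (f' \<odot> g')"
    and unit_Ob: "I \<in> Ob C"
    and a_iso: "\<lbrakk>X \<in> Ob C; Y \<in> Ob C; Z \<in> Ob C\<rbrakk>
      \<Longrightarrow> a X Y Z \<in> iso C (X \<odot>\<^sub>o (Y \<odot>\<^sub>o Z)) ((X \<odot>\<^sub>o Y) \<odot>\<^sub>o Z)"
    and a_nat: "\<lbrakk>f \<in> hom C X X'; g \<in> hom C Y Y'; h \<in> hom C Z Z'\<rbrakk>
      \<Longrightarrow> (f \<odot> (g \<odot> h)) \<Zsemi> a X' Y' Z' = a X Y Z \<Zsemi> ((f \<odot> g) \<odot> h)"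
    and uL_iso: "X \<in> Ob C \<Longrightarrow> uL X \<in> iso C (I \<odot>\<^sub>o X) X"
    and uL_nat: "f \<in> hom C X Y \<Longrightarrow> (\<one> I \<odot> f) \<Zsemi> uL Y = uL X \<Zsemi> f"
    and uR_iso: "X \<in> Ob C \<Longrightarrow> uR X \<in> iso C (X \<odot>\<^sub>o I) X"
    and uR_nat: "f \<in> hom C X Y \<Longrightarrow> (f \<odot> \<one> I) \<Zsemi> uR Y = uR X \<Zsemi> f"
    and pentagon: "\<lbrakk>W \<in> Ob C; X \<in> Ob C; Y \<in> Ob C; Z \<in> Ob C\<rbrakk>
      \<Longrightarrow> a W X (Y \<odot>\<^sub>o Z) \<Zsemi> a (W \<odot>\<^sub>o X) Y Z
        = (\<one> W \<odot> a X Y Z) \<Zsemi> a W (X \<odot>\<^sub>o Y) Z \<Zsemi> (a W X Y \<odot> \<one> Z)"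
    and triangle: "\<lbrakk>X \<in> Ob C; Y \<in> Ob C\<rbrakk>
      \<Longrightarrow> a X I Y \<Zsemi> (uR X \<odot> \<one> Y) = \<one> X \<odot> uL Y"

section \<open>Linearly distributive and isomix categories\<close>

text \<open>
  Operations on objects carry a subscript \<open>o\<close>, those on arrows do not.
\<close>

record ('o, 'm) ldc = "('o, 'm) category" +
  tensor_ob :: "'o \<Rightarrow> 'o \<Rightarrow> 'o" (infixr "\<otimes>\<^sub>o\<index>" 70)
  tensor :: "'m \<Rightarrow> 'm \<Rightarrow> 'm" (infixr "\<otimes>\<index>" 70)
  tensor_unit :: 'o ("\<top>\<index>")
  tensor_assoc :: "'o \<Rightarrow> 'o \<Rightarrow> 'o \<Rightarrow> 'm" ("a\<^sub>\<otimes>\<index>")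
  tensor_lunit :: "'o \<Rightarrow> 'm" ("u\<^sup>L\<^sub>\<otimes>\<index>")
  tensor_runit :: "'o \<Rightarrow> 'm" ("u\<^sup>R\<^sub>\<otimes>\<index>")
  par_ob :: "'o \<Rightarrow> 'o \<Rightarrow> 'o" (infixr "\<oplus>\<^sub>o\<index>" 65)
  par :: "'m \<Rightarrow> 'm \<Rightarrow> 'm" (infixr "\<oplus>\<index>" 65)
  par_unit :: 'o ("\<bottom>\<index>")
  par_assoc :: "'o \<Rightarrow> 'o \<Rightarrow> 'o \<Rightarrow> 'm" ("a\<^sub>\<oplus>\<index>")
  par_lunit :: "'o \<Rightarrow> 'm" ("u\<^sup>L\<^sub>\<oplus>\<index>")
  par_runit :: "'o \<Rightarrow> 'm" ("u\<^sup>R\<^sub>\<oplus>\<index>")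
  ldist :: "'o \<Rightarrow> 'o \<Rightarrow> 'o \<Rightarrow> 'm" ("\<partial>\<^sup>L\<index>")
  rdist :: "'o \<Rightarrow> 'o \<Rightarrow> 'o \<Rightarrow> 'm" ("\<partial>\<^sup>R\<index>")

locale ldc =
  tensor: monoidal C "tensor_ob C" "tensor C" "tensor_unit C"
    "tensor_assoc C" "tensor_lunit C" "tensor_runit C" +
  par: monoidal C "par_ob C" "par C" "par_unit C"
    "par_assoc C" "par_lunit C" "par_runit C"
  for C :: "('o, 'm, 'x) ldc_scheme" (structure) +
  assumes ldist_hom: "\<lbrakk>X \<in> Ob C; Y \<in> Ob C; Z \<in> Ob C\<rbrakk>
      \<Longrightarrow> \<partial>\<^sup>L X Y Z \<in> hom C (X \<otimes>\<^sub>o (Y \<oplus>\<^sub>o Z)) ((X \<otimes>\<^sub>o Y) \<oplus>\<^sub>o Z)"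
    and ldist_nat: "\<lbrakk>f \<in> hom C X X'; g \<in> hom C Y Y'; h \<in> hom C Z Z'\<rbrakk>
      \<Longrightarrow> (f \<otimes> (g \<oplus> h)) \<Zsemi> \<partial>\<^sup>L X' Y' Z' = \<partial>\<^sup>L X Y Z \<Zsemi> ((f \<otimes> g) \<oplus> h)"
    and rdist_hom: "\<lbrakk>X \<in> Ob C; Y \<in> Ob C; Z \<in> Ob C\<rbrakk>
      \<Longrightarrow> \<partial>\<^sup>R X Y Z \<in> hom C ((X \<oplus>\<^sub>o Y) \<otimes>\<^sub>o Z) (X \<oplus>\<^sub>o (Y \<otimes>\<^sub>o Z))"
    and rdist_nat: "\<lbrakk>f \<in> hom C X X'; g \<in> hom C Y Y'; h \<in> hom C Z Z'\<rbrakk>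
      \<Longrightarrow> ((f \<oplus> g) \<otimes> h) \<Zsemi> \<partial>\<^sup>R X' Y' Z' = \<partial>\<^sup>R X Y Z \<Zsemi> (f \<oplus> (g \<otimes> h))"
    \<comment> \<open>the Cockett--Seely coherence conditions for the non-symmetric case: units\<close>
    and ldist_tensor_unit: "\<lbrakk>X \<in> Ob C; Y \<in> Ob C\<rbrakk>
      \<Longrightarrow> \<partial>\<^sup>L \<top> X Y \<Zsemi> (u\<^sup>L\<^sub>\<otimes> X \<oplus> \<one> Y) = u\<^sup>L\<^sub>\<otimes> (X \<oplus>\<^sub>o Y)"
    and rdist_tensor_unit: "\<lbrakk>X \<in> Ob C; Y \<in> Ob C\<rbrakk>
      \<Longrightarrow> \<partial>\<^sup>R X Y \<top> \<Zsemi> (\<one> X \<oplus> u\<^sup>R\<^sub>\<otimes> Y) = u\<^sup>R\<^sub>\<otimes> (X \<oplus>\<^sub>o Y)"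
    and ldist_par_unit: "\<lbrakk>X \<in> Ob C; Y \<in> Ob C\<rbrakk>
      \<Longrightarrow> \<partial>\<^sup>L X Y \<bottom> \<Zsemi> u\<^sup>R\<^sub>\<oplus> (X \<otimes>\<^sub>o Y) = \<one> X \<otimes> u\<^sup>R\<^sub>\<oplus> Y"
    and rdist_par_unit: "\<lbrakk>X \<in> Ob C; Y \<in> Ob C\<rbrakk>
      \<Longrightarrow> \<partial>\<^sup>R \<bottom> X Y \<Zsemi> u\<^sup>L\<^sub>\<oplus> (X \<otimes>\<^sub>o Y) = u\<^sup>L\<^sub>\<oplus> X \<otimes> \<one> Y"
    \<comment> \<open>associators\<close>
    and ldist_tensor_assoc: "\<lbrakk>W \<in> Ob C; X \<in> Ob C; Y \<in> Ob C; Z \<in> Ob C\<rbrakk>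
      \<Longrightarrow> (\<one> W \<otimes> \<partial>\<^sup>L X Y Z) \<Zsemi> \<partial>\<^sup>L W (X \<otimes>\<^sub>o Y) Z \<Zsemi> (a\<^sub>\<otimes> W X Y \<oplus> \<one> Z)
        = a\<^sub>\<otimes> W X (Y \<oplus>\<^sub>o Z) \<Zsemi> \<partial>\<^sup>L (W \<otimes>\<^sub>o X) Y Z"
    and rdist_tensor_assoc: "\<lbrakk>W \<in> Ob C; X \<in> Ob C; Y \<in> Ob C; Z \<in> Ob C\<rbrakk>
      \<Longrightarrow> a\<^sub>\<otimes> (W \<oplus>\<^sub>o X) Y Z \<Zsemi> (\<partial>\<^sup>R W X Y \<otimes> \<one> Z) \<Zsemi> \<partial>\<^sup>R W (X \<otimes>\<^sub>o Y) Z
        = \<partial>\<^sup>R W X (Y \<otimes>\<^sub>o Z) \<Zsemi> (\<one> W \<oplus> a\<^sub>\<otimes> X Y Z)"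
    and ldist_par_assoc: "\<lbrakk>W \<in> Ob C; X \<in> Ob C; Y \<in> Ob C; Z \<in> Ob C\<rbrakk>
      \<Longrightarrow> (\<one> W \<otimes> a\<^sub>\<oplus> X Y Z) \<Zsemi> \<partial>\<^sup>L W (X \<oplus>\<^sub>o Y) Z \<Zsemi> (\<partial>\<^sup>L W X Y \<oplus> \<one> Z)
        = \<partial>\<^sup>L W X (Y \<oplus>\<^sub>o Z) \<Zsemi> a\<^sub>\<oplus> (W \<otimes>\<^sub>o X) Y Z"
    and rdist_par_assoc: "\<lbrakk>W \<in> Ob C; X \<in> Ob C; Y \<in> Ob C; Z \<in> Ob C\<rbrakk>
      \<Longrightarrow> \<partial>\<^sup>R W (X \<oplus>\<^sub>o Y) Z \<Zsemi> (\<one> W \<oplus> \<partial>\<^sup>R X Y Z) \<Zsemi> a\<^sub>\<oplus> W X (Y \<otimes>\<^sub>o Z)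
        = (a\<^sub>\<oplus> W X Y \<otimes> \<one> Z) \<Zsemi> \<partial>\<^sup>R (W \<oplus>\<^sub>o X) Y Z"
    \<comment> \<open>interaction of the two distributors\<close>
    and dist_tensor_assoc: "\<lbrakk>W \<in> Ob C; X \<in> Ob C; Y \<in> Ob C; Z \<in> Ob C\<rbrakk>
      \<Longrightarrow> (\<one> W \<otimes> \<partial>\<^sup>R X Y Z) \<Zsemi> \<partial>\<^sup>L W X (Y \<otimes>\<^sub>o Z)
        = a\<^sub>\<otimes> W (X \<oplus>\<^sub>o Y) Z \<Zsemi> (\<partial>\<^sup>L W X Y \<otimes> \<one> Z) \<Zsemi> \<partial>\<^sup>R (W \<otimes>\<^sub>o X) Y Z"
    and dist_par_assoc: "\<lbrakk>W \<in> Ob C; X \<in> Ob C; Y \<in> Ob C; Z \<in> Ob C\<rbrakk>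
      \<Longrightarrow> \<partial>\<^sup>R W X (Y \<oplus>\<^sub>o Z) \<Zsemi> (\<one> W \<oplus> \<partial>\<^sup>L X Y Z) \<Zsemi> a\<^sub>\<oplus> W (X \<otimes>\<^sub>o Y) Z
        = \<partial>\<^sup>L (W \<oplus>\<^sub>o X) Y Z \<Zsemi> (\<partial>\<^sup>R W X Y \<oplus> \<one> Z)"

record ('o, 'm) isomix = "('o, 'm) ldc" +
  mix :: 'm ("\<m>\<index>")

locale isomix = ldc C for C :: "('o, 'm, 'x) isomix_scheme" (structure) +
  assumes mix_iso: "\<m> \<in> iso C \<bottom> \<top>"

context
  fixes C :: "('o, 'm, 'x) isomix_scheme" (structure)
begin

definition mix_nat :: "'o \<Rightarrow> 'o \<Rightarrow> 'm" where
  "mix_nat A B =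
     (\<one> A \<otimes> (u\<^sup>L\<^sub>\<oplus> B)\<^sup>-\<^sup>1)
     \<Zsemi> (\<one> A \<otimes> (\<m> \<oplus> \<one> B))
     \<Zsemi> \<partial>\<^sup>L A \<top> B
     \<Zsemi> (u\<^sup>R\<^sub>\<otimes> A \<oplus> \<one> B)"

end

notation mix_nat ("mx\<index>")

definition core :: "('o, 'm, 'x) isomix_scheme \<Rightarrow> 'o set" where
  "core C = {A \<in> Ob C. \<forall>X \<in> Ob C.
     mx\<^bsub>C\<^esub> A X \<in> iso C (A \<otimes>\<^sub>o\<^bsub>C\<^esub> X) (A \<oplus>\<^sub>o\<^bsub>C\<^esub> X) \<and>
     mx\<^bsub>C\<^esub> X A \<in> iso C (X \<otimes>\<^sub>o\<^bsub>C\<^esub> A) (X \<oplus>\<^sub>o\<^bsub>C\<^esub> A)}"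

section \<open>Dagger structure\<close>

record ('o, 'm) dagger_isomix = "('o, 'm) isomix" +
  dagger_ob :: "'o \<Rightarrow> 'o" ("_\<^sup>\<dagger>\<^sub>o\<index>" [999] 999)
  dagger :: "'m \<Rightarrow> 'm" ("_\<^sup>\<dagger>\<index>" [999] 999)
  lam_tensor :: "'o \<Rightarrow> 'o \<Rightarrow> 'm" ("\<lambda>\<^sub>\<otimes>\<index>")
  lam_par :: "'o \<Rightarrow> 'o \<Rightarrow> 'm" ("\<lambda>\<^sub>\<oplus>\<index>")
  lam_top :: 'm ("\<lambda>\<^sub>\<top>\<index>")
  lam_bot :: 'm ("\<lambda>\<^sub>\<bottom>\<index>")
  involutor :: "'o \<Rightarrow> 'm" ("\<iota>\<index>")

locale dagger_ldc = ldc C for C :: "('o, 'm, 'x) dagger_isomix_scheme" (structure) +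
  assumes dagger_Ob: "A \<in> Ob C \<Longrightarrow> A\<^sup>\<dagger>\<^sub>o \<in> Ob C"
    and dagger_hom: "f \<in> hom C A B \<Longrightarrow> f\<^sup>\<dagger> \<in> hom C (B\<^sup>\<dagger>\<^sub>o) (A\<^sup>\<dagger>\<^sub>o)"
    and dagger_ide: "A \<in> Ob C \<Longrightarrow> (\<one> A)\<^sup>\<dagger> = \<one> (A\<^sup>\<dagger>\<^sub>o)"
    and dagger_cmp: "\<lbrakk>f \<in> hom C A B; g \<in> hom C B D\<rbrakk> \<Longrightarrow> (f \<Zsemi> g)\<^sup>\<dagger> = g\<^sup>\<dagger> \<Zsemi> f\<^sup>\<dagger>"
    and lam_tensor_iso: "\<lbrakk>A \<in> Ob C; B \<in> Ob C\<rbrakk>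
      \<Longrightarrow> \<lambda>\<^sub>\<otimes> A B \<in> iso C (A\<^sup>\<dagger>\<^sub>o \<otimes>\<^sub>o B\<^sup>\<dagger>\<^sub>o) ((A \<oplus>\<^sub>o B)\<^sup>\<dagger>\<^sub>o)"
    and lam_tensor_nat: "\<lbrakk>f \<in> hom C A A'; g \<in> hom C B B'\<rbrakk>
      \<Longrightarrow> (f\<^sup>\<dagger> \<otimes> g\<^sup>\<dagger>) \<Zsemi> \<lambda>\<^sub>\<otimes> A B = \<lambda>\<^sub>\<otimes> A' B' \<Zsemi> (f \<oplus> g)\<^sup>\<dagger>"
    and lam_par_iso: "\<lbrakk>A \<in> Ob C; B \<in> Ob C\<rbrakk>
      \<Longrightarrow> \<lambda>\<^sub>\<oplus> A B \<in> iso C (A\<^sup>\<dagger>\<^sub>o \<oplus>\<^sub>o B\<^sup>\<dagger>\<^sub>o) ((A \<otimes>\<^sub>o B)\<^sup>\<dagger>\<^sub>o)"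
    and lam_par_nat: "\<lbrakk>f \<in> hom C A A'; g \<in> hom C B B'\<rbrakk>
      \<Longrightarrow> (f\<^sup>\<dagger> \<oplus> g\<^sup>\<dagger>) \<Zsemi> \<lambda>\<^sub>\<oplus> A B = \<lambda>\<^sub>\<oplus> A' B' \<Zsemi> (f \<otimes> g)\<^sup>\<dagger>"
    and lam_top_iso: "\<lambda>\<^sub>\<top> \<in> iso C \<top> (\<bottom>\<^sup>\<dagger>\<^sub>o)"
    and lam_bot_iso: "\<lambda>\<^sub>\<bottom> \<in> iso C \<bottom> (\<top>\<^sup>\<dagger>\<^sub>o)"
    and involutor_iso: "A \<in> Ob C \<Longrightarrow> \<iota> A \<in> iso C A (A\<^sup>\<dagger>\<^sub>o\<^sup>\<dagger>\<^sub>o)"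
    and involutor_nat: "f \<in> hom C A B \<Longrightarrow> f \<Zsemi> \<iota> B = \<iota> A \<Zsemi> f\<^sup>\<dagger>\<^sup>\<dagger>"
    and lam_tensor_assoc: "\<lbrakk>A \<in> Ob C; B \<in> Ob C; D \<in> Ob C\<rbrakk>
      \<Longrightarrow> a\<^sub>\<otimes> (A\<^sup>\<dagger>\<^sub>o) (B\<^sup>\<dagger>\<^sub>o) (D\<^sup>\<dagger>\<^sub>o) \<Zsemi> (\<lambda>\<^sub>\<otimes> A B \<otimes> \<one> (D\<^sup>\<dagger>\<^sub>o)) \<Zsemi> \<lambda>\<^sub>\<otimes> (A \<oplus>\<^sub>o B) D
        = (\<one> (A\<^sup>\<dagger>\<^sub>o) \<otimes> \<lambda>\<^sub>\<otimes> B D) \<Zsemi> \<lambda>\<^sub>\<otimes> A (B \<oplus>\<^sub>o D) \<Zsemi> ((a\<^sub>\<oplus> A B D)\<^sup>-\<^sup>1)\<^sup>\<dagger>"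
    and lam_par_assoc: "\<lbrakk>A \<in> Ob C; B \<in> Ob C; D \<in> Ob C\<rbrakk>
      \<Longrightarrow> a\<^sub>\<oplus> (A\<^sup>\<dagger>\<^sub>o) (B\<^sup>\<dagger>\<^sub>o) (D\<^sup>\<dagger>\<^sub>o) \<Zsemi> (\<lambda>\<^sub>\<oplus> A B \<oplus> \<one> (D\<^sup>\<dagger>\<^sub>o)) \<Zsemi> \<lambda>\<^sub>\<oplus> (A \<otimes>\<^sub>o B) D
        = (\<one> (A\<^sup>\<dagger>\<^sub>o) \<oplus> \<lambda>\<^sub>\<oplus> B D) \<Zsemi> \<lambda>\<^sub>\<oplus> A (B \<otimes>\<^sub>o D) \<Zsemi> ((a\<^sub>\<otimes> A B D)\<^sup>-\<^sup>1)\<^sup>\<dagger>"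
    and lam_tensor_lunit: "A \<in> Ob C
      \<Longrightarrow> (\<lambda>\<^sub>\<top> \<otimes> \<one> (A\<^sup>\<dagger>\<^sub>o)) \<Zsemi> \<lambda>\<^sub>\<otimes> \<bottom> A = u\<^sup>L\<^sub>\<otimes> (A\<^sup>\<dagger>\<^sub>o) \<Zsemi> (u\<^sup>L\<^sub>\<oplus> A)\<^sup>\<dagger>"
    and lam_tensor_runit: "A \<in> Ob C
      \<Longrightarrow> (\<one> (A\<^sup>\<dagger>\<^sub>o) \<otimes> \<lambda>\<^sub>\<top>) \<Zsemi> \<lambda>\<^sub>\<otimes> A \<bottom> = u\<^sup>R\<^sub>\<otimes> (A\<^sup>\<dagger>\<^sub>o) \<Zsemi> (u\<^sup>R\<^sub>\<oplus> A)\<^sup>\<dagger>"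
    and lam_par_lunit: "A \<in> Ob C
      \<Longrightarrow> (\<lambda>\<^sub>\<bottom> \<oplus> \<one> (A\<^sup>\<dagger>\<^sub>o)) \<Zsemi> \<lambda>\<^sub>\<oplus> \<top> A = u\<^sup>L\<^sub>\<oplus> (A\<^sup>\<dagger>\<^sub>o) \<Zsemi> (u\<^sup>L\<^sub>\<otimes> A)\<^sup>\<dagger>"
    and lam_par_runit: "A \<in> Ob C
      \<Longrightarrow> (\<one> (A\<^sup>\<dagger>\<^sub>o) \<oplus> \<lambda>\<^sub>\<bottom>) \<Zsemi> \<lambda>\<^sub>\<oplus> A \<top> = u\<^sup>R\<^sub>\<oplus> (A\<^sup>\<dagger>\<^sub>o) \<Zsemi> (u\<^sup>R\<^sub>\<otimes> A)\<^sup>\<dagger>"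
    and lam_ldist: "\<lbrakk>A \<in> Ob C; B \<in> Ob C; D \<in> Ob C\<rbrakk>
      \<Longrightarrow> \<partial>\<^sup>L (A\<^sup>\<dagger>\<^sub>o) (B\<^sup>\<dagger>\<^sub>o) (D\<^sup>\<dagger>\<^sub>o) \<Zsemi> (\<lambda>\<^sub>\<otimes> A B \<oplus> \<one> (D\<^sup>\<dagger>\<^sub>o)) \<Zsemi> \<lambda>\<^sub>\<oplus> (A \<oplus>\<^sub>o B) D
        = (\<one> (A\<^sup>\<dagger>\<^sub>o) \<otimes> \<lambda>\<^sub>\<oplus> B D) \<Zsemi> \<lambda>\<^sub>\<otimes> A (B \<otimes>\<^sub>o D) \<Zsemi> (\<partial>\<^sup>R A B D)\<^sup>\<dagger>"
    and lam_rdist: "\<lbrakk>A \<in> Ob C; B \<in> Ob C; D \<in> Ob C\<rbrakk>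
      \<Longrightarrow> \<partial>\<^sup>R (A\<^sup>\<dagger>\<^sub>o) (B\<^sup>\<dagger>\<^sub>o) (D\<^sup>\<dagger>\<^sub>o) \<Zsemi> (\<one> (A\<^sup>\<dagger>\<^sub>o) \<oplus> \<lambda>\<^sub>\<otimes> B D) \<Zsemi> \<lambda>\<^sub>\<oplus> A (B \<oplus>\<^sub>o D)
        = (\<lambda>\<^sub>\<oplus> A B \<otimes> \<one> (D\<^sup>\<dagger>\<^sub>o)) \<Zsemi> \<lambda>\<^sub>\<otimes> (A \<otimes>\<^sub>o B) D \<Zsemi> (\<partial>\<^sup>L A B D)\<^sup>\<dagger>"
    and involutor_par: "\<lbrakk>A \<in> Ob C; B \<in> Ob C\<rbrakk>
      \<Longrightarrow> \<iota> (A \<oplus>\<^sub>o B) \<Zsemi> (\<lambda>\<^sub>\<otimes> A B)\<^sup>\<dagger> = (\<iota> A \<oplus> \<iota> B) \<Zsemi> \<lambda>\<^sub>\<oplus> (A\<^sup>\<dagger>\<^sub>o) (B\<^sup>\<dagger>\<^sub>o)"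
    and involutor_tensor: "\<lbrakk>A \<in> Ob C; B \<in> Ob C\<rbrakk>
      \<Longrightarrow> \<iota> (A \<otimes>\<^sub>o B) \<Zsemi> (\<lambda>\<^sub>\<oplus> A B)\<^sup>\<dagger> = (\<iota> A \<otimes> \<iota> B) \<Zsemi> \<lambda>\<^sub>\<otimes> (A\<^sup>\<dagger>\<^sub>o) (B\<^sup>\<dagger>\<^sub>o)"
    and involutor_bot: "\<iota> \<bottom> \<Zsemi> \<lambda>\<^sub>\<top>\<^sup>\<dagger> = \<lambda>\<^sub>\<bottom>"
    and involutor_top: "\<iota> \<top> \<Zsemi> \<lambda>\<^sub>\<bottom>\<^sup>\<dagger> = \<lambda>\<^sub>\<top>"
    and involutor_dagger: "A \<in> Ob C \<Longrightarrow> \<iota> (A\<^sup>\<dagger>\<^sub>o) = ((\<iota> A)\<^sup>-\<^sup>1)\<^sup>\<dagger>"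

locale dagger_isomix = isomix C + dagger_ldc C
  for C :: "('o, 'm, 'x) dagger_isomix_scheme" (structure) +
  assumes mix_dagger: "\<m> \<Zsemi> \<lambda>\<^sub>\<top> = \<lambda>\<^sub>\<bottom> \<Zsemi> \<m>\<^sup>\<dagger>"

section \<open>Unitary categories\<close>

record ('o, 'm) unitary_category = "('o, 'm) dagger_isomix" +
  ustruct :: "'o \<Rightarrow> 'm" ("\<phi>\<index>")

text \<open>The unitary structure \<open>\<phi>\<close> is not required to be natural.\<close>

locale unitary_category = dagger_isomix C
  for C :: "('o, 'm, 'x) unitary_category_scheme" (structure) +
  assumes Ob_core: "A \<in> Ob C \<Longrightarrow> A \<in> core C"
    and ustruct_iso: "A \<in> Ob C \<Longrightarrow> \<phi> A \<in> iso C A (A\<^sup>\<dagger>\<^sub>o)"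
    and ustruct_dagger: "A \<in> Ob C \<Longrightarrow> \<phi> (A\<^sup>\<dagger>\<^sub>o) = ((\<phi> A)\<^sup>-\<^sup>1)\<^sup>\<dagger>"
    and ustruct_involutor: "A \<in> Ob C \<Longrightarrow> \<phi> A \<Zsemi> \<phi> (A\<^sup>\<dagger>\<^sub>o) = \<iota> A"
    and ustruct_bot: "\<phi> \<bottom> \<Zsemi> \<lambda>\<^sub>\<top>\<^sup>-\<^sup>1 = \<m>"
    and ustruct_top: "\<lambda>\<^sub>\<bottom> \<Zsemi> (\<phi> \<top>)\<^sup>-\<^sup>1 = \<m>"
    and ustruct_par: "\<lbrakk>A \<in> Ob C; B \<in> Ob C\<rbrakk>
      \<Longrightarrow> (\<phi> A \<otimes> \<phi> B) \<Zsemi> \<lambda>\<^sub>\<otimes> A B \<Zsemi> (\<phi> (A \<oplus>\<^sub>o B))\<^sup>-\<^sup>1 = mx A B"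
    and ustruct_tensor: "\<lbrakk>A \<in> Ob C; B \<in> Ob C\<rbrakk>
      \<Longrightarrow> \<phi> (A \<otimes>\<^sub>o B) \<Zsemi> (\<lambda>\<^sub>\<oplus> A B)\<^sup>-\<^sup>1 \<Zsemi> ((\<phi> A)\<^sup>-\<^sup>1 \<oplus> (\<phi> B)\<^sup>-\<^sup>1) = mx A B"

section \<open>Functors\<close>

record ('o1, 'm1, 'o2, 'm2) isomix_functor =
  on_ob :: "'o1 \<Rightarrow> 'o2"
  on_arr :: "'m1 \<Rightarrow> 'm2"
  m_tensor :: "'o1 \<Rightarrow> 'o1 \<Rightarrow> 'm2"
  m_top :: 'm2
  n_par :: "'o1 \<Rightarrow> 'o1 \<Rightarrow> 'm2"
  n_bot :: 'm2

record ('o1, 'm1, 'o2, 'm2) dagger_isomix_functor = "('o1, 'm1, 'o2, 'm2) isomix_functor" +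
  preservator :: "'o1 \<Rightarrow> 'm2"

locale isomix_functor = source: isomix S + target: isomix C
  for S :: "('o1, 'm1, 'x) isomix_scheme"
    and C :: "('o2, 'm2, 'y) isomix_scheme" (structure) +
  fixes F :: "('o1, 'm1, 'o2, 'm2, 'z) isomix_functor_scheme"
  assumes on_ob: "A \<in> Ob S \<Longrightarrow> on_ob F A \<in> Ob C"
    and on_arr: "f \<in> hom S A B \<Longrightarrow> on_arr F f \<in> hom C (on_ob F A) (on_ob F B)"
    and on_arr_ide: "A \<in> Ob S \<Longrightarrow> on_arr F (\<one>\<^bsub>S\<^esub> A) = \<one> (on_ob F A)"
    and on_arr_cmp: "\<lbrakk>f \<in> hom S A B; g \<in> hom S B D\<rbrakk>
      \<Longrightarrow> on_arr F (f \<Zsemi>\<^bsub>S\<^esub> g) = on_arr F f \<Zsemi> on_arr F g"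
    \<comment> \<open>monoidal with respect to the tensors\<close>
    and m_tensor_hom: "\<lbrakk>A \<in> Ob S; B \<in> Ob S\<rbrakk>
      \<Longrightarrow> m_tensor F A B \<in> hom C (on_ob F A \<otimes>\<^sub>o on_ob F B) (on_ob F (A \<otimes>\<^sub>o\<^bsub>S\<^esub> B))"
    and m_tensor_nat: "\<lbrakk>f \<in> hom S A A'; g \<in> hom S B B'\<rbrakk>
      \<Longrightarrow> (on_arr F f \<otimes> on_arr F g) \<Zsemi> m_tensor F A' B'
        = m_tensor F A B \<Zsemi> on_arr F (f \<otimes>\<^bsub>S\<^esub> g)"
    and m_top_hom: "m_top F \<in> hom C \<top> (on_ob F \<top>\<^bsub>S\<^esub>)"
    and m_assoc: "\<lbrakk>A \<in> Ob S; B \<in> Ob S; D \<in> Ob S\<rbrakk>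
      \<Longrightarrow> a\<^sub>\<otimes> (on_ob F A) (on_ob F B) (on_ob F D)
          \<Zsemi> (m_tensor F A B \<otimes> \<one> (on_ob F D)) \<Zsemi> m_tensor F (A \<otimes>\<^sub>o\<^bsub>S\<^esub> B) D
        = (\<one> (on_ob F A) \<otimes> m_tensor F B D) \<Zsemi> m_tensor F A (B \<otimes>\<^sub>o\<^bsub>S\<^esub> D)
          \<Zsemi> on_arr F (a\<^sub>\<otimes>\<^bsub>S\<^esub> A B D)"
    and m_lunit: "A \<in> Ob S
      \<Longrightarrow> (m_top F \<otimes> \<one> (on_ob F A)) \<Zsemi> m_tensor F \<top>\<^bsub>S\<^esub> A \<Zsemi> on_arr F (u\<^sup>L\<^sub>\<otimes>\<^bsub>S\<^esub> A)
        = u\<^sup>L\<^sub>\<otimes> (on_ob F A)"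
    and m_runit: "A \<in> Ob S
      \<Longrightarrow> (\<one> (on_ob F A) \<otimes> m_top F) \<Zsemi> m_tensor F A \<top>\<^bsub>S\<^esub> \<Zsemi> on_arr F (u\<^sup>R\<^sub>\<otimes>\<^bsub>S\<^esub> A)
        = u\<^sup>R\<^sub>\<otimes> (on_ob F A)"
    \<comment> \<open>comonoidal with respect to the pars\<close>
    and n_par_hom: "\<lbrakk>A \<in> Ob S; B \<in> Ob S\<rbrakk>
      \<Longrightarrow> n_par F A B \<in> hom C (on_ob F (A \<oplus>\<^sub>o\<^bsub>S\<^esub> B)) (on_ob F A \<oplus>\<^sub>o on_ob F B)"
    and n_par_nat: "\<lbrakk>f \<in> hom S A A'; g \<in> hom S B B'\<rbrakk>
      \<Longrightarrow> on_arr F (f \<oplus>\<^bsub>S\<^esub> g) \<Zsemi> n_par F A' B'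
        = n_par F A B \<Zsemi> (on_arr F f \<oplus> on_arr F g)"
    and n_bot_hom: "n_bot F \<in> hom C (on_ob F \<bottom>\<^bsub>S\<^esub>) \<bottom>"
    and n_assoc: "\<lbrakk>A \<in> Ob S; B \<in> Ob S; D \<in> Ob S\<rbrakk>
      \<Longrightarrow> n_par F A (B \<oplus>\<^sub>o\<^bsub>S\<^esub> D) \<Zsemi> (\<one> (on_ob F A) \<oplus> n_par F B D)
          \<Zsemi> a\<^sub>\<oplus> (on_ob F A) (on_ob F B) (on_ob F D)
        = on_arr F (a\<^sub>\<oplus>\<^bsub>S\<^esub> A B D) \<Zsemi> n_par F (A \<oplus>\<^sub>o\<^bsub>S\<^esub> B) D
          \<Zsemi> (n_par F A B \<oplus> \<one> (on_ob F D))"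
    and n_lunit: "A \<in> Ob S
      \<Longrightarrow> n_par F \<bottom>\<^bsub>S\<^esub> A \<Zsemi> (n_bot F \<oplus> \<one> (on_ob F A)) \<Zsemi> u\<^sup>L\<^sub>\<oplus> (on_ob F A)
        = on_arr F (u\<^sup>L\<^sub>\<oplus>\<^bsub>S\<^esub> A)"
    and n_runit: "A \<in> Ob S
      \<Longrightarrow> n_par F A \<bottom>\<^bsub>S\<^esub> \<Zsemi> (\<one> (on_ob F A) \<oplus> n_bot F) \<Zsemi> u\<^sup>R\<^sub>\<oplus> (on_ob F A)
        = on_arr F (u\<^sup>R\<^sub>\<oplus>\<^bsub>S\<^esub> A)"
    \<comment> \<open>Frobenius conditions and preservation of the mix map\<close>
    and frobenius_ldist: "\<lbrakk>A \<in> Ob S; B \<in> Ob S; D \<in> Ob S\<rbrakk>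
      \<Longrightarrow> m_tensor F A (B \<oplus>\<^sub>o\<^bsub>S\<^esub> D) \<Zsemi> on_arr F (\<partial>\<^sup>L\<^bsub>S\<^esub> A B D) \<Zsemi> n_par F (A \<otimes>\<^sub>o\<^bsub>S\<^esub> B) D
        = (\<one> (on_ob F A) \<otimes> n_par F B D) \<Zsemi> \<partial>\<^sup>L (on_ob F A) (on_ob F B) (on_ob F D)
          \<Zsemi> (m_tensor F A B \<oplus> \<one> (on_ob F D))"
    and frobenius_rdist: "\<lbrakk>A \<in> Ob S; B \<in> Ob S; D \<in> Ob S\<rbrakk>
      \<Longrightarrow> m_tensor F (A \<oplus>\<^sub>o\<^bsub>S\<^esub> B) D \<Zsemi> on_arr F (\<partial>\<^sup>R\<^bsub>S\<^esub> A B D) \<Zsemi> n_par F A (B \<otimes>\<^sub>o\<^bsub>S\<^esub> D)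
        = (n_par F A B \<otimes> \<one> (on_ob F D)) \<Zsemi> \<partial>\<^sup>R (on_ob F A) (on_ob F B) (on_ob F D)
          \<Zsemi> (\<one> (on_ob F A) \<oplus> m_tensor F B D)"
    and on_mix: "on_arr F \<m>\<^bsub>S\<^esub> = n_bot F \<Zsemi> \<m> \<Zsemi> m_top F"
    and on_mix_inv: "\<m>\<^sup>-\<^sup>1 = m_top F \<Zsemi> on_arr F (\<m>\<^bsub>S\<^esub>\<^sup>-\<^sup>1\<^bsub>S\<^esub>) \<Zsemi> n_bot F"

locale strong_isomix_functor = isomix_functor S C F
  for S :: "('o1, 'm1, 'x) isomix_scheme"
    and C :: "('o2, 'm2, 'y) isomix_scheme" (structure)
    and F :: "('o1, 'm1, 'o2, 'm2, 'z) isomix_functor_scheme" +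
  assumes m_tensor_iso: "\<lbrakk>A \<in> Ob S; B \<in> Ob S\<rbrakk>
      \<Longrightarrow> m_tensor F A B \<in> iso C (on_ob F A \<otimes>\<^sub>o on_ob F B) (on_ob F (A \<otimes>\<^sub>o\<^bsub>S\<^esub> B))"
    and m_top_iso: "m_top F \<in> iso C \<top> (on_ob F \<top>\<^bsub>S\<^esub>)"
    and n_par_iso: "\<lbrakk>A \<in> Ob S; B \<in> Ob S\<rbrakk>
      \<Longrightarrow> n_par F A B \<in> iso C (on_ob F (A \<oplus>\<^sub>o\<^bsub>S\<^esub> B)) (on_ob F A \<oplus>\<^sub>o on_ob F B)"
    and n_bot_iso: "n_bot F \<in> iso C (on_ob F \<bottom>\<^bsub>S\<^esub>) \<bottom>"

locale dagger_isomix_functor =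
  source: dagger_isomix S + target: dagger_isomix C + isomix_functor S C F
  for S :: "('o1, 'm1, 'x) dagger_isomix_scheme"
    and C :: "('o2, 'm2, 'y) dagger_isomix_scheme" (structure)
    and F :: "('o1, 'm1, 'o2, 'm2, 'z) dagger_isomix_functor_scheme" +
  assumes preservator_iso: "A \<in> Ob S
      \<Longrightarrow> preservator F A \<in> iso C (on_ob F (A\<^sup>\<dagger>\<^sub>o\<^bsub>S\<^esub>)) ((on_ob F A)\<^sup>\<dagger>\<^sub>o)"
    and preservator_nat: "f \<in> hom S A B
      \<Longrightarrow> on_arr F (f\<^sup>\<dagger>\<^bsub>S\<^esub>) \<Zsemi> preservator F A = preservator F B \<Zsemi> (on_arr F f)\<^sup>\<dagger>"
    and preservator_lam_tensor: "\<lbrakk>A \<in> Ob S; B \<in> Ob S\<rbrakk>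
      \<Longrightarrow> m_tensor F (A\<^sup>\<dagger>\<^sub>o\<^bsub>S\<^esub>) (B\<^sup>\<dagger>\<^sub>o\<^bsub>S\<^esub>) \<Zsemi> on_arr F (\<lambda>\<^sub>\<otimes>\<^bsub>S\<^esub> A B) \<Zsemi> preservator F (A \<oplus>\<^sub>o\<^bsub>S\<^esub> B)
        = (preservator F A \<otimes> preservator F B) \<Zsemi> \<lambda>\<^sub>\<otimes> (on_ob F A) (on_ob F B)
          \<Zsemi> (n_par F A B)\<^sup>\<dagger>"
    and preservator_lam_top:
      "m_top F \<Zsemi> on_arr F \<lambda>\<^sub>\<top>\<^bsub>S\<^esub> \<Zsemi> preservator F \<bottom>\<^bsub>S\<^esub> = \<lambda>\<^sub>\<top> \<Zsemi> (n_bot F)\<^sup>\<dagger>"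
    and preservator_lam_par: "\<lbrakk>A \<in> Ob S; B \<in> Ob S\<rbrakk>
      \<Longrightarrow> on_arr F (\<lambda>\<^sub>\<oplus>\<^bsub>S\<^esub> A B) \<Zsemi> preservator F (A \<otimes>\<^sub>o\<^bsub>S\<^esub> B) \<Zsemi> (m_tensor F A B)\<^sup>\<dagger>
        = n_par F (A\<^sup>\<dagger>\<^sub>o\<^bsub>S\<^esub>) (B\<^sup>\<dagger>\<^sub>o\<^bsub>S\<^esub>) \<Zsemi> (preservator F A \<oplus> preservator F B)
          \<Zsemi> \<lambda>\<^sub>\<oplus> (on_ob F A) (on_ob F B)"
    and preservator_lam_bot:
      "on_arr F \<lambda>\<^sub>\<bottom>\<^bsub>S\<^esub> \<Zsemi> preservator F \<top>\<^bsub>S\<^esub> \<Zsemi> (m_top F)\<^sup>\<dagger> = n_bot F \<Zsemi> \<lambda>\<^sub>\<bottom>"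
    and preservator_involutor: "A \<in> Ob S
      \<Longrightarrow> \<iota> (on_ob F A) \<Zsemi> (preservator F A)\<^sup>\<dagger>
        = on_arr F (\<iota>\<^bsub>S\<^esub> A) \<Zsemi> preservator F (A\<^sup>\<dagger>\<^sub>o\<^bsub>S\<^esub>)"

section \<open>Mixed unitary categories\<close>

locale mixed_unitary_category =
  source: unitary_category U + target: dagger_isomix C +
  dagger_isomix_functor U C M + strong_isomix_functor U C M
  for U :: "('uo, 'um, 'x) unitary_category_scheme"
    and C :: "('co, 'cm, 'y) dagger_isomix_scheme" (structure)
    and M :: "('uo, 'um, 'co, 'cm, 'z) dagger_isomix_functor_scheme" +
  assumes on_ob_core: "V \<in> Ob U \<Longrightarrow> on_ob M V \<in> core C"

section \<open>Kraus maps and the CP-infinity construction\<close>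

context
  fixes U :: "('uo, 'um, 'x) unitary_category_scheme"
    and C :: "('co, 'cm, 'y) dagger_isomix_scheme" (structure)
    and M :: "('uo, 'um, 'co, 'cm, 'z) dagger_isomix_functor_scheme"
begin

definition kraus_maps :: "'co \<Rightarrow> 'co \<Rightarrow> ('cm \<times> 'uo) set" where
  "kraus_maps A B = {(f, V). V \<in> Ob U \<and> f \<in> hom C A (on_ob M V \<oplus>\<^sub>o B)}"

text \<open>
  \<open>kraus_test A B D W h (f, V) : A \<otimes> D \<rightarrow> (A \<otimes> D)\<^sup>\<dagger>\<close> is the test of \<open>f : A \<rightarrow> M V \<oplus> B\<close>
  against \<open>h : B \<otimes> D \<rightarrow> M W\<close>.
\<close>

definition kraus_test :: "'co \<Rightarrow> 'co \<Rightarrow> 'co \<Rightarrow> 'uo \<Rightarrow> 'cm \<Rightarrow> 'cm \<times> 'uo \<Rightarrow> 'cm" where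
  "kraus_test A B D W h = (\<lambda>(f, V).
     (f \<otimes> \<one> D)
     \<Zsemi> \<partial>\<^sup>R (on_ob M V) B D
     \<Zsemi> (\<one> (on_ob M V) \<oplus> h)
     \<Zsemi> (mx (on_ob M V) (on_ob M W))\<^sup>-\<^sup>1
     \<Zsemi> (on_arr M (\<phi>\<^bsub>U\<^esub> V) \<otimes> on_arr M (\<phi>\<^bsub>U\<^esub> W))
     \<Zsemi> (preservator M V \<otimes> preservator M W)
     \<Zsemi> (\<one> ((on_ob M V)\<^sup>\<dagger>\<^sub>o) \<otimes> (h\<^sup>\<dagger> \<Zsemi> (\<lambda>\<^sub>\<oplus> B D)\<^sup>-\<^sup>1))
     \<Zsemi> \<partial>\<^sup>L ((on_ob M V)\<^sup>\<dagger>\<^sub>o) (B\<^sup>\<dagger>\<^sub>o) (D\<^sup>\<dagger>\<^sub>o)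
     \<Zsemi> (\<lambda>\<^sub>\<otimes> (on_ob M V) B \<oplus> \<one> (D\<^sup>\<dagger>\<^sub>o))
     \<Zsemi> (f\<^sup>\<dagger> \<oplus> \<one> (D\<^sup>\<dagger>\<^sub>o))
     \<Zsemi> \<lambda>\<^sub>\<oplus> A D)"

definition kraus_equiv :: "'co \<Rightarrow> 'co \<Rightarrow> (('cm \<times> 'uo) \<times> ('cm \<times> 'uo)) set" where
  "kraus_equiv A B =
     {(p, q). p \<in> kraus_maps A B \<and> q \<in> kraus_maps A B \<and>
        (\<forall>D \<in> Ob C. \<forall>W \<in> Ob U. \<forall>h \<in> hom C (B \<otimes>\<^sub>o D) (on_ob M W).
           kraus_test A B D W h p = kraus_test A B D W h q)}"

definition kraus_comp :: "'co \<Rightarrow> 'cm \<times> 'uo \<Rightarrow> 'cm \<times> 'uo \<Rightarrow> 'cm \<times> 'uo" where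
  "kraus_comp D = (\<lambda>(f, V) (g, W).
     (f \<Zsemi> (\<one> (on_ob M V) \<oplus> g) \<Zsemi> a\<^sub>\<oplus> (on_ob M V) (on_ob M W) D
        \<Zsemi> ((n_par M V W)\<^sup>-\<^sup>1 \<oplus> \<one> D),
      V \<oplus>\<^sub>o\<^bsub>U\<^esub> W))"

definition kraus_id :: "'co \<Rightarrow> 'cm \<times> 'uo" where
  "kraus_id A = ((u\<^sup>L\<^sub>\<oplus> A)\<^sup>-\<^sup>1 \<Zsemi> ((n_bot M)\<^sup>-\<^sup>1 \<oplus> \<one> A), \<bottom>\<^bsub>U\<^esub>)"

text \<open>
  A map \<open>A \<rightarrow> B\<close> is an equivalence class of Kraus maps tagged with its domain and codomain.
  The composite of two classes is the union of the classes of the composites of all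
  representatives; it is a single class, as closure under composition demands, precisely
  when composition of Kraus maps respects the equivalence.
\<close>

definition CP_infty :: "('co, 'co \<times> ('cm \<times> 'uo) set \<times> 'co) category" where
  "CP_infty =
     \<lparr>Ob = Ob C,
      Arr = {(A, P, B). A \<in> Ob C \<and> B \<in> Ob C \<and> P \<in> kraus_maps A B // kraus_equiv A B},
      Dom = (\<lambda>(A, P, B). A),
      Cod = (\<lambda>(A, P, B). B),
      ide = (\<lambda>A. (A, kraus_equiv A A `` {kraus_id A}, A)),
      cmp = (\<lambda>(A, P, B) (B', Q, D).
        (A, \<Union>p \<in> P. \<Union>q \<in> Q. kraus_equiv A D `` {kraus_comp D p q}, D))\<rparr>"

end

end

theory Submission
  imports Defs
begin

text \<open>
  Kraus maps are identified when all their tests agree, so everything rests on writing a test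
  in a form that follows composition. For an object \<open>V\<close> of the unitary category let
  \<open>\<psi>\<close> be the map \<open>M(\<phi>) ; \<rho>\<close> from \<open>M V\<close> to its dagger (\<open>form\<close>), and let the square of
  \<open>k : Z \<rightarrow> M V\<close> be \<open>k ; \<psi> ; k\<^sup>\<dagger>\<close>. The test of \<open>f : A \<rightarrow> M V \<oplus> B\<close> against an effect
  \<open>h : B \<otimes> D \<rightarrow> M W\<close> has two descriptions.

  First, it is the square of the map \<open>(f \<otimes> 1) ; \<partial>\<^sup>R ; (1 \<oplus> h) ; n\<^sup>-\<^sup>1 : A \<otimes> D \<rightarrow> M (V \<oplus> W)\<close>, in
  which \<open>f\<close> absorbs \<open>h\<close> and the two ancillas are merged into one
  (\<open>absorb\<close>, \<open>kraus_test_eq_square\<close>). This uses that \<open>M\<close> preserves the mix map and that \<open>\<phi>\<close> on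
  a par is determined by \<open>\<phi>\<close> on its factors. Secondly, \<open>h\<close> can be slid along the mix map
  towards \<open>h\<^sup>\<dagger>\<close>, so the test depends on \<open>h\<close> only through its square
  (\<open>surround\<close>, \<open>kraus_test_eq_surround\<close>).

  Call a map of the unitary category unitary if it transports \<open>\<phi>\<close> to \<open>\<phi>\<close>; the image of such
  a map can be appended without changing a square. A composite \<open>f ; g\<close> absorbs \<open>h\<close> by letting
  \<open>g\<close> absorb it and then \<open>f\<close> absorb the result, up to an associator, and the identity absorbs
  \<open>h\<close> up to a left unitor (\<open>absorb_comp\<close>, \<open>absorb_id\<close>). Since associator and unitor of the par
  are unitary, the test of \<open>f ; g\<close> against \<open>h\<close> is a test of \<open>f\<close>, and it is also obtained by
  surrounding the test of \<open>g\<close> against \<open>h\<close> with \<open>f\<close>. The former shows that it depends only on the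
  class of \<open>f\<close>, the latter that it depends only on the class of \<open>g\<close>, so composition of classes
  is well defined. The unit and associativity laws follow by rewriting the tests of both sides with
  these two descriptions.

  The remaining work is the unitarity of associator and unitor. As \<open>\<phi>\<close> on a par is
  \<open>mx\<^sup>-\<^sup>1 ; (\<phi> \<otimes> \<phi>) ; \<lambda>\<^sub>\<otimes>\<close>, it amounts to the compatibility of the mix map with the
  associators and left unitors of the two monoidal structures (\<open>mx_assoc\<close>, \<open>mx_lunit\<close>), which
  follows from the linear distributivity axioms and Kelly's unit lemmas.
\<close>

section \<open>Arrows and isomorphisms\<close>

lemma hom_iff: "f \<in> hom C A B \<longleftrightarrow> f \<in> Arr C \<and> Dom C f = A \<and> Cod C f = B"
  by (auto simp: hom_def)

context category
begin

text \<open>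
  Isomorphy is phrased with the domain and codomain of the arrow itself, so that conditional
  rewrite rules about inverses have no premises with undetermined objects.
\<close>

abbreviation iso_arrow :: "'m \<Rightarrow> bool" where
  "iso_arrow f \<equiv> f \<in> iso C (Dom C f) (Cod C f)"

lemma arr_simps [simp]:
  "f \<in> Arr C \<Longrightarrow> Dom C f \<in> Ob C"
  "f \<in> Arr C \<Longrightarrow> Cod C f \<in> Ob C"
  "A \<in> Ob C \<Longrightarrow> \<one> A \<in> Arr C"
  "A \<in> Ob C \<Longrightarrow> Dom C (\<one> A) = A"
  "A \<in> Ob C \<Longrightarrow> Cod C (\<one> A) = A"
  using Dom_Ob Cod_Ob ide_hom by (auto simp: hom_iff)

lemma cmp_simps [simp]:
  assumes "f \<in> Arr C" "g \<in> Arr C" "Cod C f = Dom C g"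
  shows "f \<Zsemi> g \<in> Arr C" "Dom C (f \<Zsemi> g) = Dom C f" "Cod C (f \<Zsemi> g) = Cod C g"
  using cmp_hom[of f "Dom C f" "Cod C f" g "Cod C g"] assms by (auto simp: hom_iff)

lemma ide_cmp_simps [simp]:
  "f \<in> Arr C \<Longrightarrow> A = Dom C f \<Longrightarrow> \<one> A \<Zsemi> f = f"
  "f \<in> Arr C \<Longrightarrow> A = Cod C f \<Longrightarrow> f \<Zsemi> \<one> A = f"
  using ide_cmp cmp_ide by (auto simp: hom_iff)

lemma cmp_assoc_simp [simp]:
  "\<lbrakk>f \<in> Arr C; g \<in> Arr C; h \<in> Arr C; Cod C f = Dom C g; Cod C g = Dom C h\<rbrakk>
    \<Longrightarrow> (f \<Zsemi> g) \<Zsemi> h = f \<Zsemi> (g \<Zsemi> h)"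
  using cmp_assoc by (auto simp: hom_iff)

text \<open>
  Composites are kept associated to the right; this rule lets an equation between composites
  be used as a rewrite rule in front of a further factor.
\<close>

lemma cmp_prefix:
  assumes "f \<Zsemi> g = k" "f \<in> Arr C" "g \<in> Arr C" "h \<in> Arr C" "Cod C f = Dom C g" "Cod C g = Dom C h"
  shows "f \<Zsemi> (g \<Zsemi> h) = k \<Zsemi> h"
  using assms cmp_assoc_simp by metis

lemma inverse_arrows_unique:
  assumes "f \<in> Arr C" "inverse_arrows C f g" "inverse_arrows C f g'"
  shows "g = g'"
proof -
  have "g = g \<Zsemi> (f \<Zsemi> g')"
    using assms by (simp add: inverse_arrows_def hom_iff)
  also have "\<dots> = (g \<Zsemi> f) \<Zsemi> g'"
    using assms cmp_assoc_simp[of g f g'] by (simp add: inverse_arrows_def hom_iff)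
  also have "\<dots> = g'"
    using assms by (simp add: inverse_arrows_def hom_iff)
  finally show ?thesis .
qed

lemma inverse_inv_arrow:
  assumes "f \<in> iso C A B" shows "inverse_arrows C f (f\<^sup>-\<^sup>1)"
proof -
  obtain g where "inverse_arrows C f g" "f \<in> Arr C"
    using assms by (auto simp: iso_def hom_iff)
  then show ?thesis
    unfolding inv_arrow_def by (metis theI inverse_arrows_unique)
qed

lemma inv_simps [simp]:
  assumes "iso_arrow f"
  shows "f\<^sup>-\<^sup>1 \<in> Arr C" "Dom C (f\<^sup>-\<^sup>1) = Cod C f" "Cod C (f\<^sup>-\<^sup>1) = Dom C f"
    and inv_cancel: "f \<Zsemi> f\<^sup>-\<^sup>1 = \<one> (Dom C f)" "f\<^sup>-\<^sup>1 \<Zsemi> f = \<one> (Cod C f)"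
  using inverse_inv_arrow[OF assms] assms by (auto simp: inverse_arrows_def hom_iff iso_def)

lemma iso_arrow_Arr: "iso_arrow f \<Longrightarrow> f \<in> Arr C"
  by (simp add: iso_def hom_iff)

lemma inv_cancel_prefix [simp]:
  "\<lbrakk>iso_arrow f; h \<in> Arr C; Dom C h = Dom C f\<rbrakk> \<Longrightarrow> f \<Zsemi> (f\<^sup>-\<^sup>1 \<Zsemi> h) = h"
  "\<lbrakk>iso_arrow f; h \<in> Arr C; Dom C h = Cod C f\<rbrakk> \<Longrightarrow> f\<^sup>-\<^sup>1 \<Zsemi> (f \<Zsemi> h) = h"
  by (simp_all add: cmp_prefix[OF inv_cancel(1)] cmp_prefix[OF inv_cancel(2)] iso_arrow_Arr)

lemma isoI:
  assumes f: "f \<in> Arr C" "Dom C f = A" "Cod C f = B" and g: "g \<in> Arr C" "Dom C g = B" "Cod C g = A"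
    and fg: "f \<Zsemi> g = \<one> A" "g \<Zsemi> f = \<one> B"
  shows "f \<in> iso C A B"
proof -
  have inv: "inverse_arrows C f g" using assms by (auto simp: inverse_arrows_def hom_iff)
  then show "f \<in> iso C A B" using assms by (auto simp: iso_def hom_iff)
qed

lemma ide_iso [simp]: "A \<in> Ob C \<Longrightarrow> \<one> A \<in> iso C A A"
  by (rule isoI[where g = "\<one> A"]) simp_all

lemma iso_cancel_left:
  assumes "iso_arrow e" "f \<in> Arr C" "g \<in> Arr C" "Dom C f = Cod C e" "Dom C g = Cod C e"
    and eq: "e \<Zsemi> f = e \<Zsemi> g"
  shows "f = g"
  using assms inv_cancel_prefix(2) by metis

lemma iso_cancel_right:
  assumes e: "iso_arrow e" and fg: "f \<in> Arr C" "g \<in> Arr C" "Cod C f = Dom C e" "Cod C g = Dom C e"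
    and eq: "f \<Zsemi> e = g \<Zsemi> e"
  shows "f = g"
proof -
  have "e \<in> Arr C" using e iso_arrow_Arr by simp
  have "f = (f \<Zsemi> e) \<Zsemi> e\<^sup>-\<^sup>1" using e fg \<open>e \<in> Arr C\<close> by simp
  also have "\<dots> = g" using e fg \<open>e \<in> Arr C\<close> by (simp add: eq)
  finally show ?thesis .
qed

end

section \<open>Units in monoidal categories\<close>

context monoidal
begin

lemma tar_simps [simp]:
  assumes "f \<in> Arr C" "g \<in> Arr C"
  shows "f \<odot> g \<in> Arr C" "Dom C (f \<odot> g) = Dom C f \<odot>\<^sub>o Dom C g" "Cod C (f \<odot> g) = Cod C f \<odot>\<^sub>o Cod C g"
  using tar_hom[of f "Dom C f" "Cod C f" g "Dom C g" "Cod C g"] assms by (auto simp: hom_iff)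

lemma structure_simps [simp]:
  "\<lbrakk>A \<in> Ob C; B \<in> Ob C\<rbrakk> \<Longrightarrow> A \<odot>\<^sub>o B \<in> Ob C"
  "I \<in> Ob C"
  "\<lbrakk>A \<in> Ob C; B \<in> Ob C\<rbrakk> \<Longrightarrow> \<one> A \<odot> \<one> B = \<one> (A \<odot>\<^sub>o B)"
  "\<lbrakk>X \<in> Ob C; Y \<in> Ob C; Z \<in> Ob C\<rbrakk> \<Longrightarrow> a X Y Z \<in> Arr C"
  "\<lbrakk>X \<in> Ob C; Y \<in> Ob C; Z \<in> Ob C\<rbrakk> \<Longrightarrow> Dom C (a X Y Z) = X \<odot>\<^sub>o (Y \<odot>\<^sub>o Z)"
  "\<lbrakk>X \<in> Ob C; Y \<in> Ob C; Z \<in> Ob C\<rbrakk> \<Longrightarrow> Cod C (a X Y Z) = (X \<odot>\<^sub>o Y) \<odot>\<^sub>o Z"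
  "\<lbrakk>X \<in> Ob C; Y \<in> Ob C; Z \<in> Ob C\<rbrakk> \<Longrightarrow> a X Y Z \<in> iso C (X \<odot>\<^sub>o (Y \<odot>\<^sub>o Z)) ((X \<odot>\<^sub>o Y) \<odot>\<^sub>o Z)"
  "X \<in> Ob C \<Longrightarrow> uL X \<in> Arr C"
  "X \<in> Ob C \<Longrightarrow> Dom C (uL X) = I \<odot>\<^sub>o X"
  "X \<in> Ob C \<Longrightarrow> Cod C (uL X) = X"
  "X \<in> Ob C \<Longrightarrow> uL X \<in> iso C (I \<odot>\<^sub>o X) X"
  "X \<in> Ob C \<Longrightarrow> uR X \<in> Arr C"
  "X \<in> Ob C \<Longrightarrow> Dom C (uR X) = X \<odot>\<^sub>o I"
  "X \<in> Ob C \<Longrightarrow> Cod C (uR X) = X"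
  "X \<in> Ob C \<Longrightarrow> uR X \<in> iso C (X \<odot>\<^sub>o I) X"
  using tob_Ob unit_Ob tar_ide a_iso uL_iso uR_iso by (auto simp: iso_def hom_iff)

lemma interchange [simp]:
  assumes "f \<in> Arr C" "f' \<in> Arr C" "g \<in> Arr C" "g' \<in> Arr C" "Cod C f = Dom C f'" "Cod C g = Dom C g'"
  shows "(f \<odot> g) \<Zsemi> (f' \<odot> g') = (f \<Zsemi> f') \<odot> (g \<Zsemi> g')"
  using tar_cmp assms by (simp add: hom_iff)

lemma interchange_prefix [simp]:
  assumes "f \<in> Arr C" "f' \<in> Arr C" "g \<in> Arr C" "g' \<in> Arr C" "Cod C f = Dom C f'" "Cod C g = Dom C g'"
    "h \<in> Arr C" "Dom C h = Cod C f' \<odot>\<^sub>o Cod C g'"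
  shows "(f \<odot> g) \<Zsemi> ((f' \<odot> g') \<Zsemi> h) = ((f \<Zsemi> f') \<odot> (g \<Zsemi> g')) \<Zsemi> h"
  using cmp_prefix[OF interchange] assms by simp

lemma tar_iso [simp]:
  assumes "f \<in> iso C A A'" "g \<in> iso C B B'"
  shows "f \<odot> g \<in> iso C (A \<odot>\<^sub>o B) (A' \<odot>\<^sub>o B')"
proof -
  have f: "f \<in> Arr C" "Dom C f = A" "Cod C f = A'" and g: "g \<in> Arr C" "Dom C g = B" "Cod C g = B'"
    using assms by (auto simp: iso_def hom_iff)
  have Ob: "A \<in> Ob C" "A' \<in> Ob C" "B \<in> Ob C" "B' \<in> Ob C" using f g by auto
  show "f \<odot> g \<in> iso C (A \<odot>\<^sub>o B) (A' \<odot>\<^sub>o B')"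
    by (rule isoI[where g = "f\<^sup>-\<^sup>1 \<odot> g\<^sup>-\<^sup>1"]) (use assms f g Ob in simp_all)
qed

lemma assoc_natural:
  assumes "f \<in> Arr C" "g \<in> Arr C" "h \<in> Arr C" "Dom C f = X" "Dom C g = Y" "Dom C h = Z"
  shows "a X Y Z \<Zsemi> ((f \<odot> g) \<odot> h) = (f \<odot> (g \<odot> h)) \<Zsemi> a (Cod C f) (Cod C g) (Cod C h)"
  using a_nat[of f X "Cod C f" g Y "Cod C g" h Z "Cod C h"] assms by (simp add: hom_iff)

lemma lunit_natural:
  assumes "f \<in> Arr C" "Cod C f = Y"
  shows "(\<one> I \<odot> f) \<Zsemi> uL Y = uL (Dom C f) \<Zsemi> f"
  using uL_nat[of f "Dom C f" Y] assms by (simp add: hom_iff)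

lemma runit_natural:
  assumes "f \<in> Arr C" "Cod C f = Y"
  shows "(f \<odot> \<one> I) \<Zsemi> uR Y = uR (Dom C f) \<Zsemi> f"
  using uR_nat[of f "Dom C f" Y] assms by (simp add: hom_iff)

lemma lunit_inv_natural:
  assumes f: "f \<in> Arr C" "Dom C f = X"
  shows "(uL X)\<^sup>-\<^sup>1 \<Zsemi> (\<one> I \<odot> f) = f \<Zsemi> (uL (Cod C f))\<^sup>-\<^sup>1"
proof -
  have X: "X \<in> Ob C" using f by auto
  show ?thesis
    by (rule iso_cancel_right[of "uL (Cod C f)"]) (use f X in \<open>simp_all add: lunit_natural\<close>)
qed

lemma unit_tensor_faithful:
  assumes "f \<in> Arr C" "g \<in> Arr C" "Dom C f = Dom C g" "Cod C f = Cod C g" "\<one> I \<odot> f = \<one> I \<odot> g"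
  shows "f = g"
proof (rule iso_cancel_left[of "uL (Dom C f)"])
  show "uL (Dom C f) \<Zsemi> f = uL (Dom C f) \<Zsemi> g"
    using assms lunit_natural[of f] lunit_natural[of g] by metis
qed (use assms in simp_all)

lemma tensor_unit_faithful:
  assumes "f \<in> Arr C" "g \<in> Arr C" "Dom C f = Dom C g" "Cod C f = Cod C g" "f \<odot> \<one> I = g \<odot> \<one> I"
  shows "f = g"
proof (rule iso_cancel_left[of "uR (Dom C f)"])
  show "uR (Dom C f) \<Zsemi> f = uR (Dom C f) \<Zsemi> g"
    using assms runit_natural[of f] runit_natural[of g] by metis
qed (use assms in simp_all)

text \<open>
  Kelly's unit lemmas: the triangle for a unit in the middle forces the triangles for a unit
  on either side. For a unit on the left, the pentagon with two units in front is followed by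
  \<open>(uR I \<odot> \<one> X) \<odot> \<one> Y\<close>; the triangle rewrites both sides, the invertible associator cancels,
  and \<open>I \<odot> -\<close> is faithful because \<open>uL\<close> is a natural isomorphism.
\<close>

lemma lunit_tensor:
  assumes X: "X \<in> Ob C" and Y: "Y \<in> Ob C"
  shows "a I X Y \<Zsemi> (uL X \<odot> \<one> Y) = uL (X \<odot>\<^sub>o Y)"
proof -
  have "(\<one> I \<odot> (a I X Y \<Zsemi> (uL X \<odot> \<one> Y))) \<Zsemi> a I X Y
      = (\<one> I \<odot> a I X Y) \<Zsemi> (a I (I \<odot>\<^sub>o X) Y \<Zsemi> ((\<one> I \<odot> uL X) \<odot> \<one> Y))"
    using X Y by (simp add: assoc_natural)
  also have "\<dots> = ((\<one> I \<odot> a I X Y) \<Zsemi> a I (I \<odot>\<^sub>o X) Y \<Zsemi> (a I I X \<odot> \<one> Y)) \<Zsemi> ((uR I \<odot> \<one> X) \<odot> \<one> Y)"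
    using X Y by (simp add: triangle)
  also have "\<dots> = a I I (X \<odot>\<^sub>o Y) \<Zsemi> (a (I \<odot>\<^sub>o I) X Y \<Zsemi> ((uR I \<odot> \<one> X) \<odot> \<one> Y))"
    using X Y by (simp only: pentagon[symmetric] structure_simps) simp
  also have "\<dots> = (a I I (X \<odot>\<^sub>o Y) \<Zsemi> (uR I \<odot> \<one> (X \<odot>\<^sub>o Y))) \<Zsemi> a I X Y"
    using X Y by (simp add: assoc_natural)
  also have "\<dots> = (\<one> I \<odot> uL (X \<odot>\<^sub>o Y)) \<Zsemi> a I X Y"
    using X Y by (simp only: triangle structure_simps)
  finally have "\<one> I \<odot> (a I X Y \<Zsemi> (uL X \<odot> \<one> Y)) = \<one> I \<odot> uL (X \<odot>\<^sub>o Y)"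
    using X Y iso_cancel_right[of "a I X Y"] by simp
  then show ?thesis
    using X Y unit_tensor_faithful by simp
qed

text \<open>
  Here the pentagon carries two units in the last places; applying \<open>- \<odot> I\<close> is faithful because
  \<open>uR\<close> is a natural isomorphism.
\<close>

lemma runit_tensor:
  assumes X: "X \<in> Ob C" and Y: "Y \<in> Ob C"
  shows "a X Y I \<Zsemi> uR (X \<odot>\<^sub>o Y) = \<one> X \<odot> uR Y"
proof -
  let ?c = "(\<one> X \<odot> a Y I I) \<Zsemi> a X (Y \<odot>\<^sub>o I) I"
  have iso: "iso_arrow (\<one> X \<odot> a Y I I)"
    using X Y by simp
  have "?c \<Zsemi> ((a X Y I \<Zsemi> uR (X \<odot>\<^sub>o Y)) \<odot> \<one> I)
      = (?c \<Zsemi> (a X Y I \<odot> \<one> I)) \<Zsemi> (uR (X \<odot>\<^sub>o Y) \<odot> \<one> I)"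
    using X Y by simp
  also have "\<dots> = a X Y (I \<odot>\<^sub>o I) \<Zsemi> (a (X \<odot>\<^sub>o Y) I I \<Zsemi> (uR (X \<odot>\<^sub>o Y) \<odot> \<one> I))"
    using X Y by (simp only: pentagon[symmetric] structure_simps) simp
  also have "\<dots> = a X Y (I \<odot>\<^sub>o I) \<Zsemi> ((\<one> X \<odot> \<one> Y) \<odot> uL I)"
    using X Y by (simp add: triangle)
  also have "\<dots> = (\<one> X \<odot> (\<one> Y \<odot> uL I)) \<Zsemi> a X Y I"
    using X Y by (subst assoc_natural) simp_all
  also have "\<dots> = (\<one> X \<odot> (a Y I I \<Zsemi> (uR Y \<odot> \<one> I))) \<Zsemi> a X Y I"
    using X Y by (simp add: triangle)
  also have "\<dots> = ?c \<Zsemi> ((\<one> X \<odot> uR Y) \<odot> \<one> I)"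
    using X Y by (simp add: assoc_natural)
  finally have "a X (Y \<odot>\<^sub>o I) I \<Zsemi> ((a X Y I \<Zsemi> uR (X \<odot>\<^sub>o Y)) \<odot> \<one> I)
      = a X (Y \<odot>\<^sub>o I) I \<Zsemi> ((\<one> X \<odot> uR Y) \<odot> \<one> I)"
    using X Y iso by - (rule iso_cancel_left[OF iso], simp_all)
  then have "(a X Y I \<Zsemi> uR (X \<odot>\<^sub>o Y)) \<odot> \<one> I = (\<one> X \<odot> uR Y) \<odot> \<one> I"
    using X Y by - (rule iso_cancel_left[of "a X (Y \<odot>\<^sub>o I) I"], simp_all)
  then show ?thesis
    using X Y tensor_unit_faithful by simp
qed

text \<open>
  Naturality of \<open>uL\<close> at \<open>uL I\<close> gives \<open>uL (I \<odot>\<^sub>o I) = \<one> I \<odot> uL I\<close>, so the triangle and the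
  left unit law \<open>lunit_tensor\<close> express the same map through \<open>uR I\<close> and through \<open>uL I\<close>.
\<close>

lemma lunit_unit_eq_runit_unit: "uL I = uR I"
proof -
  have "uL (I \<odot>\<^sub>o I) = \<one> I \<odot> uL I"
    using lunit_natural[of "uL I" I] by - (rule iso_cancel_right[of "uL I"], simp_all)
  then have "a I I I \<Zsemi> (uL I \<odot> \<one> I) = a I I I \<Zsemi> (uR I \<odot> \<one> I)"
    by (simp add: triangle lunit_tensor)
  then have "uL I \<odot> \<one> I = uR I \<odot> \<one> I"
    by - (rule iso_cancel_left[of "a I I I"], simp_all)
  then show ?thesis
    using tensor_unit_faithful by simp
qed

end

section \<open>The mix map\<close>

context ldc
begin

lemma dist_simps [simp]:
  assumes "X \<in> Ob C" "Y \<in> Ob C" "Z \<in> Ob C"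
  shows "\<partial>\<^sup>L X Y Z \<in> Arr C" "Dom C (\<partial>\<^sup>L X Y Z) = X \<otimes>\<^sub>o (Y \<oplus>\<^sub>o Z)" "Cod C (\<partial>\<^sup>L X Y Z) = (X \<otimes>\<^sub>o Y) \<oplus>\<^sub>o Z"
    "\<partial>\<^sup>R X Y Z \<in> Arr C" "Dom C (\<partial>\<^sup>R X Y Z) = (X \<oplus>\<^sub>o Y) \<otimes>\<^sub>o Z" "Cod C (\<partial>\<^sup>R X Y Z) = X \<oplus>\<^sub>o (Y \<otimes>\<^sub>o Z)"
  using ldist_hom rdist_hom assms by (auto simp: hom_iff)

lemma ldist_natural:
  assumes "f \<in> Arr C" "g \<in> Arr C" "h \<in> Arr C" "Dom C f = X" "Dom C g = Y" "Dom C h = Z"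
  shows "\<partial>\<^sup>L X Y Z \<Zsemi> ((f \<otimes> g) \<oplus> h) = (f \<otimes> (g \<oplus> h)) \<Zsemi> \<partial>\<^sup>L (Cod C f) (Cod C g) (Cod C h)"
  using ldist_nat[of f X "Cod C f" g Y "Cod C g" h Z "Cod C h"] assms by (simp add: hom_iff)

lemma rdist_natural:
  assumes "f \<in> Arr C" "g \<in> Arr C" "h \<in> Arr C" "Dom C f = X" "Dom C g = Y" "Dom C h = Z"
  shows "\<partial>\<^sup>R X Y Z \<Zsemi> (f \<oplus> (g \<otimes> h)) = ((f \<oplus> g) \<otimes> h) \<Zsemi> \<partial>\<^sup>R (Cod C f) (Cod C g) (Cod C h)"
  using rdist_nat[of f X "Cod C f" g Y "Cod C g" h Z "Cod C h"] assms by (simp add: hom_iff)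

end

context isomix
begin

lemma mix_simps [simp]:
  "\<m> \<in> Arr C" "Dom C \<m> = \<bottom>" "Cod C \<m> = \<top>" "\<m> \<in> iso C \<bottom> \<top>"
  using mix_iso by (auto simp: iso_def hom_iff)

text \<open>
  The part of the mix map that acts on its second argument alone. With it the mix map is
  \<open>(1 \<otimes> insert_top) ; \<partial>\<^sup>L ; (u\<^sup>R\<^sub>\<otimes> \<oplus> 1)\<close>, and the coherence properties of the mix map are proved
  factor by factor.
\<close>

definition insert_top :: "'o \<Rightarrow> 'm" where
  "insert_top B = (u\<^sup>L\<^sub>\<oplus> B)\<^sup>-\<^sup>1 \<Zsemi> (\<m> \<oplus> \<one> B)"

lemma insert_top_simps [simp]:
  assumes "B \<in> Ob C"
  shows "insert_top B \<in> Arr C" "Dom C (insert_top B) = B" "Cod C (insert_top B) = \<top> \<oplus>\<^sub>o B"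
  using assms by (simp_all add: insert_top_def)

lemma insert_top_natural:
  assumes "f \<in> Arr C" "Dom C f = B"
  shows "insert_top B \<Zsemi> (\<one> \<top> \<oplus> f) = f \<Zsemi> insert_top (Cod C f)"
proof -
  have B: "B \<in> Ob C" using assms by auto
  have "insert_top B \<Zsemi> (\<one> \<top> \<oplus> f) = ((u\<^sup>L\<^sub>\<oplus> B)\<^sup>-\<^sup>1 \<Zsemi> (\<one> \<bottom> \<oplus> f)) \<Zsemi> (\<m> \<oplus> \<one> (Cod C f))"
    using assms B by (simp add: insert_top_def)
  then show ?thesis
    using assms B by (simp add: par.lunit_inv_natural insert_top_def del: par.interchange)
qed

lemma insert_top_par:
  assumes B: "B \<in> Ob C" and D: "D \<in> Ob C"
  shows "insert_top (B \<oplus>\<^sub>o D) \<Zsemi> a\<^sub>\<oplus> \<top> B D = insert_top B \<oplus> \<one> D"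
proof -
  have lunit: "(u\<^sup>L\<^sub>\<oplus> (B \<oplus>\<^sub>o D))\<^sup>-\<^sup>1 \<Zsemi> a\<^sub>\<oplus> \<bottom> B D = (u\<^sup>L\<^sub>\<oplus> B)\<^sup>-\<^sup>1 \<oplus> \<one> D"
    by (rule tensor.iso_cancel_right[of "u\<^sup>L\<^sub>\<oplus> B \<oplus> \<one> D"]) (use B D in \<open>simp_all add: par.lunit_tensor\<close>)
  have "insert_top (B \<oplus>\<^sub>o D) \<Zsemi> a\<^sub>\<oplus> \<top> B D
      = (u\<^sup>L\<^sub>\<oplus> (B \<oplus>\<^sub>o D))\<^sup>-\<^sup>1 \<Zsemi> ((\<m> \<oplus> (\<one> B \<oplus> \<one> D)) \<Zsemi> a\<^sub>\<oplus> \<top> B D)"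
    using B D by (simp add: insert_top_def)
  also have "(\<m> \<oplus> (\<one> B \<oplus> \<one> D)) \<Zsemi> a\<^sub>\<oplus> \<top> B D = a\<^sub>\<oplus> \<bottom> B D \<Zsemi> ((\<m> \<oplus> \<one> B) \<oplus> \<one> D)"
    using B D by (subst par.assoc_natural) simp_all
  also have "(u\<^sup>L\<^sub>\<oplus> (B \<oplus>\<^sub>o D))\<^sup>-\<^sup>1 \<Zsemi> \<dots> = insert_top B \<oplus> \<one> D"
    using B D by (simp add: insert_top_def tensor.cmp_prefix[OF lunit])
  finally show ?thesis .
qed

lemma mx_eq:
  assumes "A \<in> Ob C" "B \<in> Ob C"
  shows "mx A B = (\<one> A \<otimes> insert_top B) \<Zsemi> (\<partial>\<^sup>L A \<top> B \<Zsemi> (u\<^sup>R\<^sub>\<otimes> A \<oplus> \<one> B))"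
  using assms by (simp add: mix_nat_def insert_top_def)

lemma mx_simps [simp]:
  assumes "A \<in> Ob C" "B \<in> Ob C"
  shows "mx A B \<in> Arr C" "Dom C (mx A B) = A \<otimes>\<^sub>o B" "Cod C (mx A B) = A \<oplus>\<^sub>o B"
  using assms by (simp_all add: mx_eq)

lemma mx_natural:
  assumes "f \<in> Arr C" "g \<in> Arr C" "Dom C f = A" "Dom C g = B"
  shows "mx A B \<Zsemi> (f \<oplus> g) = (f \<otimes> g) \<Zsemi> mx (Cod C f) (Cod C g)"
proof -
  have Ob: "A \<in> Ob C" "B \<in> Ob C" using assms by auto
  have "mx A B \<Zsemi> (f \<oplus> g)
      = (\<one> A \<otimes> insert_top B) \<Zsemi> (\<partial>\<^sup>L A \<top> B \<Zsemi> ((u\<^sup>R\<^sub>\<otimes> A \<Zsemi> f) \<oplus> g))"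
    using assms Ob by (simp add: mx_eq)
  also have "u\<^sup>R\<^sub>\<otimes> A \<Zsemi> f = (f \<otimes> \<one> \<top>) \<Zsemi> u\<^sup>R\<^sub>\<otimes> (Cod C f)"
    using assms by (simp add: tensor.runit_natural)
  also have "\<partial>\<^sup>L A \<top> B \<Zsemi> (((f \<otimes> \<one> \<top>) \<Zsemi> u\<^sup>R\<^sub>\<otimes> (Cod C f)) \<oplus> g)
      = (\<partial>\<^sup>L A \<top> B \<Zsemi> ((f \<otimes> \<one> \<top>) \<oplus> g)) \<Zsemi> (u\<^sup>R\<^sub>\<otimes> (Cod C f) \<oplus> \<one> (Cod C g))"
    using assms Ob by simp
  also have "(\<one> A \<otimes> insert_top B) \<Zsemi> \<dots>
      = (f \<otimes> (insert_top B \<Zsemi> (\<one> \<top> \<oplus> g))) \<Zsemi> (\<partial>\<^sup>L (Cod C f) \<top> (Cod C g) \<Zsemi> (u\<^sup>R\<^sub>\<otimes> (Cod C f) \<oplus> \<one> (Cod C g)))"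
    using assms Ob by (simp add: ldist_natural)
  also have "\<dots> = (f \<otimes> g) \<Zsemi> mx (Cod C f) (Cod C g)"
    using assms Ob by (simp add: insert_top_natural mx_eq)
  finally show ?thesis .
qed

text \<open>
  The next two lemmas describe the left distributor between two mix maps: preceded by a mix map
  on its last two arguments, or followed by one on its first two, it becomes a single mix map up
  to an associator. The first is the tensor associativity axiom of \<open>\<partial>\<^sup>L\<close> with a tensor unit in
  third position, the second its par associativity axiom with a tensor unit in second position.
\<close>

lemma mx_ldist_tensor:
  assumes A: "A \<in> Ob C" and B: "B \<in> Ob C" and D: "D \<in> Ob C"
  shows "(\<one> A \<otimes> mx B D) \<Zsemi> \<partial>\<^sup>L A B D = a\<^sub>\<otimes> A B D \<Zsemi> mx (A \<otimes>\<^sub>o B) D"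
proof -
  have "(\<one> A \<otimes> mx B D) \<Zsemi> \<partial>\<^sup>L A B D
      = (\<one> A \<otimes> ((\<one> B \<otimes> insert_top D) \<Zsemi> \<partial>\<^sup>L B \<top> D)) \<Zsemi> ((\<one> A \<otimes> (u\<^sup>R\<^sub>\<otimes> B \<oplus> \<one> D)) \<Zsemi> \<partial>\<^sup>L A B D)"
    using A B D by (simp add: mx_eq)
  also have "(\<one> A \<otimes> (u\<^sup>R\<^sub>\<otimes> B \<oplus> \<one> D)) \<Zsemi> \<partial>\<^sup>L A B D = \<partial>\<^sup>L A (B \<otimes>\<^sub>o \<top>) D \<Zsemi> ((\<one> A \<otimes> u\<^sup>R\<^sub>\<otimes> B) \<oplus> \<one> D)"
    using A B D by (simp add: ldist_natural)
  also have "(\<one> A \<otimes> u\<^sup>R\<^sub>\<otimes> B) = a\<^sub>\<otimes> A B \<top> \<Zsemi> u\<^sup>R\<^sub>\<otimes> (A \<otimes>\<^sub>o B)"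
    using A B by (simp add: tensor.runit_tensor)
  also have "(\<one> A \<otimes> ((\<one> B \<otimes> insert_top D) \<Zsemi> \<partial>\<^sup>L B \<top> D))
        \<Zsemi> (\<partial>\<^sup>L A (B \<otimes>\<^sub>o \<top>) D \<Zsemi> ((a\<^sub>\<otimes> A B \<top> \<Zsemi> u\<^sup>R\<^sub>\<otimes> (A \<otimes>\<^sub>o B)) \<oplus> \<one> D))
      = (\<one> A \<otimes> (\<one> B \<otimes> insert_top D))
        \<Zsemi> ((\<one> A \<otimes> \<partial>\<^sup>L B \<top> D) \<Zsemi> \<partial>\<^sup>L A (B \<otimes>\<^sub>o \<top>) D \<Zsemi> (a\<^sub>\<otimes> A B \<top> \<oplus> \<one> D))
        \<Zsemi> (u\<^sup>R\<^sub>\<otimes> (A \<otimes>\<^sub>o B) \<oplus> \<one> D)"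
    using A B D by simp
  also have "\<dots> = ((\<one> A \<otimes> (\<one> B \<otimes> insert_top D)) \<Zsemi> a\<^sub>\<otimes> A B (\<top> \<oplus>\<^sub>o D))
        \<Zsemi> (\<partial>\<^sup>L (A \<otimes>\<^sub>o B) \<top> D \<Zsemi> (u\<^sup>R\<^sub>\<otimes> (A \<otimes>\<^sub>o B) \<oplus> \<one> D))"
    using A B D by (simp only: ldist_tensor_assoc tensor.structure_simps) simp
  also have "(\<one> A \<otimes> (\<one> B \<otimes> insert_top D)) \<Zsemi> a\<^sub>\<otimes> A B (\<top> \<oplus>\<^sub>o D)
      = a\<^sub>\<otimes> A B D \<Zsemi> ((\<one> A \<otimes> \<one> B) \<otimes> insert_top D)"
    using A B D by (subst tensor.assoc_natural) simp_all
  also have "\<dots> \<Zsemi> (\<partial>\<^sup>L (A \<otimes>\<^sub>o B) \<top> D \<Zsemi> (u\<^sup>R\<^sub>\<otimes> (A \<otimes>\<^sub>o B) \<oplus> \<one> D)) = a\<^sub>\<otimes> A B D \<Zsemi> mx (A \<otimes>\<^sub>o B) D"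
    using A B D by (simp add: mx_eq)
  finally show ?thesis .
qed

lemma mx_ldist_par:
  assumes A: "A \<in> Ob C" and B: "B \<in> Ob C" and D: "D \<in> Ob C"
  shows "mx A (B \<oplus>\<^sub>o D) \<Zsemi> a\<^sub>\<oplus> A B D = \<partial>\<^sup>L A B D \<Zsemi> (mx A B \<oplus> \<one> D)"
proof -
  have "mx A (B \<oplus>\<^sub>o D) \<Zsemi> a\<^sub>\<oplus> A B D
      = (\<one> A \<otimes> insert_top (B \<oplus>\<^sub>o D)) \<Zsemi> (\<partial>\<^sup>L A \<top> (B \<oplus>\<^sub>o D) \<Zsemi> ((u\<^sup>R\<^sub>\<otimes> A \<oplus> (\<one> B \<oplus> \<one> D)) \<Zsemi> a\<^sub>\<oplus> A B D))"
    using A B D by (simp add: mx_eq)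
  also have "(u\<^sup>R\<^sub>\<otimes> A \<oplus> (\<one> B \<oplus> \<one> D)) \<Zsemi> a\<^sub>\<oplus> A B D = a\<^sub>\<oplus> (A \<otimes>\<^sub>o \<top>) B D \<Zsemi> ((u\<^sup>R\<^sub>\<otimes> A \<oplus> \<one> B) \<oplus> \<one> D)"
    using A B D by (subst par.assoc_natural) simp_all
  also have "(\<one> A \<otimes> insert_top (B \<oplus>\<^sub>o D)) \<Zsemi> (\<partial>\<^sup>L A \<top> (B \<oplus>\<^sub>o D) \<Zsemi> \<dots>)
      = (\<one> A \<otimes> insert_top (B \<oplus>\<^sub>o D)) \<Zsemi> ((\<partial>\<^sup>L A \<top> (B \<oplus>\<^sub>o D) \<Zsemi> a\<^sub>\<oplus> (A \<otimes>\<^sub>o \<top>) B D) \<Zsemi> ((u\<^sup>R\<^sub>\<otimes> A \<oplus> \<one> B) \<oplus> \<one> D))"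
    using A B D by simp
  also have "\<partial>\<^sup>L A \<top> (B \<oplus>\<^sub>o D) \<Zsemi> a\<^sub>\<oplus> (A \<otimes>\<^sub>o \<top>) B D
      = (\<one> A \<otimes> a\<^sub>\<oplus> \<top> B D) \<Zsemi> (\<partial>\<^sup>L A (\<top> \<oplus>\<^sub>o B) D \<Zsemi> (\<partial>\<^sup>L A \<top> B \<oplus> \<one> D))"
    using A B D by (simp add: ldist_par_assoc[symmetric])
  also have "(\<one> A \<otimes> insert_top (B \<oplus>\<^sub>o D)) \<Zsemi> (\<dots> \<Zsemi> ((u\<^sup>R\<^sub>\<otimes> A \<oplus> \<one> B) \<oplus> \<one> D))
      = ((\<one> A \<otimes> (insert_top B \<oplus> \<one> D)) \<Zsemi> \<partial>\<^sup>L A (\<top> \<oplus>\<^sub>o B) D) \<Zsemi> ((\<partial>\<^sup>L A \<top> B \<Zsemi> (u\<^sup>R\<^sub>\<otimes> A \<oplus> \<one> B)) \<oplus> \<one> D)"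
    using A B D by (simp add: insert_top_par)
  also have "(\<one> A \<otimes> (insert_top B \<oplus> \<one> D)) \<Zsemi> \<partial>\<^sup>L A (\<top> \<oplus>\<^sub>o B) D = \<partial>\<^sup>L A B D \<Zsemi> ((\<one> A \<otimes> insert_top B) \<oplus> \<one> D)"
    using A B D by (simp add: ldist_natural)
  also have "\<dots> \<Zsemi> ((\<partial>\<^sup>L A \<top> B \<Zsemi> (u\<^sup>R\<^sub>\<otimes> A \<oplus> \<one> B)) \<oplus> \<one> D) = \<partial>\<^sup>L A B D \<Zsemi> (mx A B \<oplus> \<one> D)"
    using A B D by (simp add: mx_eq)
  finally show ?thesis .
qed

text \<open>
  Both sides equal \<open>(1 \<otimes> mx) ; \<partial>\<^sup>L ; (mx \<oplus> 1)\<close> by the two preceding lemmas and naturality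
  of the mix map.
\<close>

lemma mx_assoc:
  assumes A: "A \<in> Ob C" and B: "B \<in> Ob C" and D: "D \<in> Ob C"
  shows "(\<one> A \<otimes> mx B D) \<Zsemi> (mx A (B \<oplus>\<^sub>o D) \<Zsemi> a\<^sub>\<oplus> A B D)
    = a\<^sub>\<otimes> A B D \<Zsemi> ((mx A B \<otimes> \<one> D) \<Zsemi> mx (A \<oplus>\<^sub>o B) D)"
proof -
  have "(\<one> A \<otimes> mx B D) \<Zsemi> (mx A (B \<oplus>\<^sub>o D) \<Zsemi> a\<^sub>\<oplus> A B D)
      = ((\<one> A \<otimes> mx B D) \<Zsemi> \<partial>\<^sup>L A B D) \<Zsemi> (mx A B \<oplus> \<one> D)"
    using A B D by (simp add: mx_ldist_par)
  also have "\<dots> = a\<^sub>\<otimes> A B D \<Zsemi> (mx (A \<otimes>\<^sub>o B) D \<Zsemi> (mx A B \<oplus> \<one> D))"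
    using A B D by (simp add: mx_ldist_tensor del: tensor.cmp_assoc_simp) simp
  also have "\<dots> = a\<^sub>\<otimes> A B D \<Zsemi> ((mx A B \<otimes> \<one> D) \<Zsemi> mx (A \<oplus>\<^sub>o B) D)"
    using A B D by (simp add: mx_natural)
  finally show ?thesis .
qed

text \<open>
  Conjugating with \<open>\<m>\<close> replaces the first argument by the tensor unit. There the mix map collapses,
  because the left and right unitors agree at the unit and \<open>\<partial>\<^sup>L\<close> respects left unitors.
\<close>

lemma mx_lunit:
  assumes B: "B \<in> Ob C"
  shows "mx \<bottom> B \<Zsemi> u\<^sup>L\<^sub>\<oplus> B = (\<m> \<otimes> \<one> B) \<Zsemi> u\<^sup>L\<^sub>\<otimes> B"
proof -
  have "mx \<bottom> B = mx \<bottom> B \<Zsemi> ((\<m> \<oplus> \<one> B) \<Zsemi> (\<m>\<^sup>-\<^sup>1 \<oplus> \<one> B))"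
    using B by simp
  also have "\<dots> = (mx \<bottom> B \<Zsemi> (\<m> \<oplus> \<one> B)) \<Zsemi> (\<m>\<^sup>-\<^sup>1 \<oplus> \<one> B)"
    using B by simp
  also have "mx \<bottom> B \<Zsemi> (\<m> \<oplus> \<one> B) = (\<m> \<otimes> \<one> B) \<Zsemi> mx \<top> B"
    using B by (simp add: mx_natural)
  also have "mx \<top> B = (\<one> \<top> \<otimes> insert_top B) \<Zsemi> (\<partial>\<^sup>L \<top> \<top> B \<Zsemi> (u\<^sup>L\<^sub>\<otimes> \<top> \<oplus> \<one> B))"
    using B by (simp add: mx_eq tensor.lunit_unit_eq_runit_unit)
  also have "\<dots> = u\<^sup>L\<^sub>\<otimes> B \<Zsemi> insert_top B"
    using B by (simp add: ldist_tensor_unit tensor.lunit_natural)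
  finally show ?thesis
    using B by (simp add: insert_top_def)
qed

end

section \<open>Unitary structure\<close>

context dagger_ldc
begin

lemma dagger_simps [simp]:
  "A \<in> Ob C \<Longrightarrow> A\<^sup>\<dagger>\<^sub>o \<in> Ob C"
  "f \<in> Arr C \<Longrightarrow> f\<^sup>\<dagger> \<in> Arr C"
  "f \<in> Arr C \<Longrightarrow> Dom C (f\<^sup>\<dagger>) = (Cod C f)\<^sup>\<dagger>\<^sub>o"
  "f \<in> Arr C \<Longrightarrow> Cod C (f\<^sup>\<dagger>) = (Dom C f)\<^sup>\<dagger>\<^sub>o"
  "A \<in> Ob C \<Longrightarrow> (\<one> A)\<^sup>\<dagger> = \<one> (A\<^sup>\<dagger>\<^sub>o)"
  "\<lbrakk>f \<in> Arr C; g \<in> Arr C; Cod C f = Dom C g\<rbrakk> \<Longrightarrow> (f \<Zsemi> g)\<^sup>\<dagger> = g\<^sup>\<dagger> \<Zsemi> f\<^sup>\<dagger>"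
  using dagger_Ob dagger_hom dagger_ide dagger_cmp by (simp_all add: hom_iff)

lemma lam_simps [simp]:
  "\<lbrakk>A \<in> Ob C; B \<in> Ob C\<rbrakk> \<Longrightarrow> \<lambda>\<^sub>\<otimes> A B \<in> Arr C"
  "\<lbrakk>A \<in> Ob C; B \<in> Ob C\<rbrakk> \<Longrightarrow> Dom C (\<lambda>\<^sub>\<otimes> A B) = A\<^sup>\<dagger>\<^sub>o \<otimes>\<^sub>o B\<^sup>\<dagger>\<^sub>o"
  "\<lbrakk>A \<in> Ob C; B \<in> Ob C\<rbrakk> \<Longrightarrow> Cod C (\<lambda>\<^sub>\<otimes> A B) = (A \<oplus>\<^sub>o B)\<^sup>\<dagger>\<^sub>o"
  "\<lbrakk>A \<in> Ob C; B \<in> Ob C\<rbrakk> \<Longrightarrow> \<lambda>\<^sub>\<otimes> A B \<in> iso C (A\<^sup>\<dagger>\<^sub>o \<otimes>\<^sub>o B\<^sup>\<dagger>\<^sub>o) ((A \<oplus>\<^sub>o B)\<^sup>\<dagger>\<^sub>o)"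
  "\<lbrakk>A \<in> Ob C; B \<in> Ob C\<rbrakk> \<Longrightarrow> \<lambda>\<^sub>\<oplus> A B \<in> Arr C"
  "\<lbrakk>A \<in> Ob C; B \<in> Ob C\<rbrakk> \<Longrightarrow> Dom C (\<lambda>\<^sub>\<oplus> A B) = A\<^sup>\<dagger>\<^sub>o \<oplus>\<^sub>o B\<^sup>\<dagger>\<^sub>o"
  "\<lbrakk>A \<in> Ob C; B \<in> Ob C\<rbrakk> \<Longrightarrow> Cod C (\<lambda>\<^sub>\<oplus> A B) = (A \<otimes>\<^sub>o B)\<^sup>\<dagger>\<^sub>o"
  "\<lbrakk>A \<in> Ob C; B \<in> Ob C\<rbrakk> \<Longrightarrow> \<lambda>\<^sub>\<oplus> A B \<in> iso C (A\<^sup>\<dagger>\<^sub>o \<oplus>\<^sub>o B\<^sup>\<dagger>\<^sub>o) ((A \<otimes>\<^sub>o B)\<^sup>\<dagger>\<^sub>o)"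
  "\<lambda>\<^sub>\<top> \<in> Arr C" "Dom C \<lambda>\<^sub>\<top> = \<top>" "Cod C \<lambda>\<^sub>\<top> = \<bottom>\<^sup>\<dagger>\<^sub>o" "\<lambda>\<^sub>\<top> \<in> iso C \<top> (\<bottom>\<^sup>\<dagger>\<^sub>o)"
  using lam_tensor_iso lam_par_iso lam_top_iso by (auto simp: iso_def hom_iff)

lemma lam_tensor_natural:
  assumes "f \<in> Arr C" "g \<in> Arr C" "Cod C f = A" "Cod C g = B"
  shows "\<lambda>\<^sub>\<otimes> A B \<Zsemi> (f \<oplus> g)\<^sup>\<dagger> = (f\<^sup>\<dagger> \<otimes> g\<^sup>\<dagger>) \<Zsemi> \<lambda>\<^sub>\<otimes> (Dom C f) (Dom C g)"
  using lam_tensor_nat[of f "Dom C f" A g "Dom C g" B] assms by (simp add: hom_iff)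

lemma lam_par_natural:
  assumes "f \<in> Arr C" "g \<in> Arr C" "Cod C f = A" "Cod C g = B"
  shows "\<lambda>\<^sub>\<oplus> A B \<Zsemi> (f \<otimes> g)\<^sup>\<dagger> = (f\<^sup>\<dagger> \<oplus> g\<^sup>\<dagger>) \<Zsemi> \<lambda>\<^sub>\<oplus> (Dom C f) (Dom C g)"
  using lam_par_nat[of f "Dom C f" A g "Dom C g" B] assms by (simp add: hom_iff)

end

context unitary_category
begin

lemma ustruct_simps [simp]:
  assumes "A \<in> Ob C"
  shows "\<phi> A \<in> Arr C" "Dom C (\<phi> A) = A" "Cod C (\<phi> A) = A\<^sup>\<dagger>\<^sub>o" "\<phi> A \<in> iso C A (A\<^sup>\<dagger>\<^sub>o)"
  using ustruct_iso[OF assms] by (auto simp: iso_def hom_iff)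

lemma mx_iso [simp]:
  assumes "A \<in> Ob C" "B \<in> Ob C"
  shows "mx A B \<in> iso C (A \<otimes>\<^sub>o B) (A \<oplus>\<^sub>o B)"
  using Ob_core[OF assms(1)] assms(2) by (simp add: core_def)

text \<open>
  As \<open>\<phi>\<close> is not natural, a map need not intertwine it; the maps that do are the ones that tests
  cannot detect.
\<close>

definition unitary :: "'o \<Rightarrow> 'o \<Rightarrow> 'm \<Rightarrow> bool" where
  "unitary A B w \<longleftrightarrow> w \<in> hom C A B \<and> w \<Zsemi> (\<phi> B \<Zsemi> w\<^sup>\<dagger>) = \<phi> A"

lemma mx_ustruct_par:
  assumes "A \<in> Ob C" "B \<in> Ob C"
  shows "mx A B \<Zsemi> \<phi> (A \<oplus>\<^sub>o B) = (\<phi> A \<otimes> \<phi> B) \<Zsemi> \<lambda>\<^sub>\<otimes> A B"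
  using assms by (simp add: ustruct_par[symmetric])

lemma mx3_ustruct_par:
  assumes A: "A \<in> Ob C" and B: "B \<in> Ob C" and D: "D \<in> Ob C"
  shows "(\<one> A \<otimes> mx B D) \<Zsemi> (mx A (B \<oplus>\<^sub>o D) \<Zsemi> \<phi> (A \<oplus>\<^sub>o (B \<oplus>\<^sub>o D)))
      = (\<phi> A \<otimes> (\<phi> B \<otimes> \<phi> D)) \<Zsemi> ((\<one> (A\<^sup>\<dagger>\<^sub>o) \<otimes> \<lambda>\<^sub>\<otimes> B D) \<Zsemi> \<lambda>\<^sub>\<otimes> A (B \<oplus>\<^sub>o D))"
    "(mx A B \<otimes> \<one> D) \<Zsemi> (mx (A \<oplus>\<^sub>o B) D \<Zsemi> \<phi> ((A \<oplus>\<^sub>o B) \<oplus>\<^sub>o D))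
      = ((\<phi> A \<otimes> \<phi> B) \<otimes> \<phi> D) \<Zsemi> ((\<lambda>\<^sub>\<otimes> A B \<otimes> \<one> (D\<^sup>\<dagger>\<^sub>o)) \<Zsemi> \<lambda>\<^sub>\<otimes> (A \<oplus>\<^sub>o B) D)"
  using A B D by (simp_all add: mx_ustruct_par)

text \<open>
  Cleared of inverse mix maps, the unitary structures on the two bracketings are threefold tensors
  of \<open>\<phi>\<close> followed by \<open>\<lambda>\<^sub>\<otimes>\<close>. The associators between the two are matched on the left by
  \<open>mx_assoc\<close> and on the right by the axiom relating \<open>\<lambda>\<^sub>\<otimes>\<close> to the associators.
\<close>

lemma par_assoc_unitary:
  assumes A: "A \<in> Ob C" and B: "B \<in> Ob C" and D: "D \<in> Ob C"
  shows "unitary (A \<oplus>\<^sub>o (B \<oplus>\<^sub>o D)) ((A \<oplus>\<^sub>o B) \<oplus>\<^sub>o D) (a\<^sub>\<oplus> A B D)"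
proof -
  let ?a = "a\<^sub>\<oplus> A B D" and ?e = "(\<one> A \<otimes> mx B D) \<Zsemi> mx A (B \<oplus>\<^sub>o D)"
  let ?\<phi> = "\<phi> ((A \<oplus>\<^sub>o B) \<oplus>\<^sub>o D)"
  have a_dagger: "(?a\<^sup>-\<^sup>1)\<^sup>\<dagger> \<Zsemi> ?a\<^sup>\<dagger> = \<one> ((A \<oplus>\<^sub>o (B \<oplus>\<^sub>o D))\<^sup>\<dagger>\<^sub>o)"
    using A B D dagger_simps(6)[of ?a "?a\<^sup>-\<^sup>1", symmetric] by simp
  have "(\<one> A \<otimes> mx B D) \<Zsemi> (mx A (B \<oplus>\<^sub>o D) \<Zsemi> (?a \<Zsemi> (?\<phi> \<Zsemi> ?a\<^sup>\<dagger>)))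
      = ((\<one> A \<otimes> mx B D) \<Zsemi> (mx A (B \<oplus>\<^sub>o D) \<Zsemi> ?a)) \<Zsemi> (?\<phi> \<Zsemi> ?a\<^sup>\<dagger>)"
    using A B D by simp
  also have "\<dots> = a\<^sub>\<otimes> A B D \<Zsemi> (((mx A B \<otimes> \<one> D) \<Zsemi> (mx (A \<oplus>\<^sub>o B) D \<Zsemi> ?\<phi>)) \<Zsemi> ?a\<^sup>\<dagger>)"
    using A B D unfolding mx_assoc[OF A B D] by simp
  also have "\<dots> = (a\<^sub>\<otimes> A B D \<Zsemi> ((\<phi> A \<otimes> \<phi> B) \<otimes> \<phi> D))
      \<Zsemi> ((\<lambda>\<^sub>\<otimes> A B \<otimes> \<one> (D\<^sup>\<dagger>\<^sub>o)) \<Zsemi> (\<lambda>\<^sub>\<otimes> (A \<oplus>\<^sub>o B) D \<Zsemi> ?a\<^sup>\<dagger>))"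
    using A B D unfolding mx3_ustruct_par(2)[OF A B D] by simp
  also have "\<dots> = (\<phi> A \<otimes> (\<phi> B \<otimes> \<phi> D))
      \<Zsemi> ((a\<^sub>\<otimes> (A\<^sup>\<dagger>\<^sub>o) (B\<^sup>\<dagger>\<^sub>o) (D\<^sup>\<dagger>\<^sub>o) \<Zsemi> (\<lambda>\<^sub>\<otimes> A B \<otimes> \<one> (D\<^sup>\<dagger>\<^sub>o)) \<Zsemi> \<lambda>\<^sub>\<otimes> (A \<oplus>\<^sub>o B) D) \<Zsemi> ?a\<^sup>\<dagger>)"
    using A B D by (subst tensor.assoc_natural) simp_all
  also have "\<dots> = (\<phi> A \<otimes> (\<phi> B \<otimes> \<phi> D))
      \<Zsemi> ((\<one> (A\<^sup>\<dagger>\<^sub>o) \<otimes> \<lambda>\<^sub>\<otimes> B D) \<Zsemi> (\<lambda>\<^sub>\<otimes> A (B \<oplus>\<^sub>o D) \<Zsemi> ((?a\<^sup>-\<^sup>1)\<^sup>\<dagger> \<Zsemi> ?a\<^sup>\<dagger>)))"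
    using A B D by (subst lam_tensor_assoc) simp_all
  also have "\<dots> = (\<one> A \<otimes> mx B D) \<Zsemi> (mx A (B \<oplus>\<^sub>o D) \<Zsemi> \<phi> (A \<oplus>\<^sub>o (B \<oplus>\<^sub>o D)))"
    using A B D unfolding a_dagger mx3_ustruct_par(1)[OF A B D] by simp
  finally have "mx A (B \<oplus>\<^sub>o D) \<Zsemi> (?a \<Zsemi> (?\<phi> \<Zsemi> ?a\<^sup>\<dagger>)) = mx A (B \<oplus>\<^sub>o D) \<Zsemi> \<phi> (A \<oplus>\<^sub>o (B \<oplus>\<^sub>o D))"
    using A B D by - (rule tensor.iso_cancel_left[of "\<one> A \<otimes> mx B D"], simp_all)
  then have "?a \<Zsemi> (?\<phi> \<Zsemi> ?a\<^sup>\<dagger>) = \<phi> (A \<oplus>\<^sub>o (B \<oplus>\<^sub>o D))"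
    using A B D by - (rule tensor.iso_cancel_left[of "mx A (B \<oplus>\<^sub>o D)"], simp_all)
  then show ?thesis
    using A B D by (simp add: unitary_def hom_iff)
qed

text \<open>
  Since \<open>\<phi> \<bottom> = \<m> \<Zsemi> \<lambda>\<^sub>\<top>\<close>, the factor \<open>\<m>\<close> is the one produced by \<open>mx_lunit\<close>, and \<open>\<lambda>\<^sub>\<top>\<close> is absorbed
  by the unit axiom for \<open>\<lambda>\<^sub>\<otimes>\<close>.
\<close>

lemma par_lunit_inv_unitary:
  assumes A: "A \<in> Ob C"
  shows "unitary A (\<bottom> \<oplus>\<^sub>o A) ((u\<^sup>L\<^sub>\<oplus> A)\<^sup>-\<^sup>1)"
proof -
  let ?u = "u\<^sup>L\<^sub>\<oplus> A"
  have u_dagger: "?u\<^sup>\<dagger> \<Zsemi> (?u\<^sup>-\<^sup>1)\<^sup>\<dagger> = \<one> (A\<^sup>\<dagger>\<^sub>o)"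
    using A dagger_simps(6)[of "?u\<^sup>-\<^sup>1" ?u, symmetric] by simp
  have \<phi>_bot: "\<phi> \<bottom> = \<m> \<Zsemi> \<lambda>\<^sub>\<top>"
    by (simp add: ustruct_bot[symmetric])
  have "mx \<bottom> A \<Zsemi> (?u \<Zsemi> (\<phi> A \<Zsemi> ?u\<^sup>\<dagger>)) = (mx \<bottom> A \<Zsemi> ?u) \<Zsemi> (\<phi> A \<Zsemi> ?u\<^sup>\<dagger>)"
    using A by simp
  also have "\<dots> = (\<m> \<otimes> \<one> A) \<Zsemi> ((u\<^sup>L\<^sub>\<otimes> A \<Zsemi> \<phi> A) \<Zsemi> ?u\<^sup>\<dagger>)"
    using A unfolding mx_lunit[OF A] by simp
  also have "u\<^sup>L\<^sub>\<otimes> A \<Zsemi> \<phi> A = (\<one> \<top> \<otimes> \<phi> A) \<Zsemi> u\<^sup>L\<^sub>\<otimes> (A\<^sup>\<dagger>\<^sub>o)"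
    using A by (simp add: tensor.lunit_natural)
  also have "(\<m> \<otimes> \<one> A) \<Zsemi> (\<dots> \<Zsemi> ?u\<^sup>\<dagger>) = (\<m> \<otimes> \<phi> A) \<Zsemi> (u\<^sup>L\<^sub>\<otimes> (A\<^sup>\<dagger>\<^sub>o) \<Zsemi> ?u\<^sup>\<dagger>)"
    using A by simp
  also have "\<dots> = (\<phi> \<bottom> \<otimes> \<phi> A) \<Zsemi> \<lambda>\<^sub>\<otimes> \<bottom> A"
    using A by (simp add: lam_tensor_lunit[symmetric] \<phi>_bot)
  also have "\<dots> = mx \<bottom> A \<Zsemi> \<phi> (\<bottom> \<oplus>\<^sub>o A)"
    using A by (simp add: mx_ustruct_par)
  finally have "?u \<Zsemi> (\<phi> A \<Zsemi> ?u\<^sup>\<dagger>) = \<phi> (\<bottom> \<oplus>\<^sub>o A)"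
    using A by - (rule tensor.iso_cancel_left[of "mx \<bottom> A"], simp_all)
  then have "?u\<^sup>-\<^sup>1 \<Zsemi> (\<phi> (\<bottom> \<oplus>\<^sub>o A) \<Zsemi> (?u\<^sup>-\<^sup>1)\<^sup>\<dagger>) = ?u\<^sup>-\<^sup>1 \<Zsemi> ((?u \<Zsemi> (\<phi> A \<Zsemi> ?u\<^sup>\<dagger>)) \<Zsemi> (?u\<^sup>-\<^sup>1)\<^sup>\<dagger>)"
    by simp
  also have "\<dots> = \<phi> A \<Zsemi> (?u\<^sup>\<dagger> \<Zsemi> (?u\<^sup>-\<^sup>1)\<^sup>\<dagger>)"
    using A by simp
  finally show ?thesis
    using A by (simp add: u_dagger unitary_def hom_iff)
qed

end

section \<open>Isomix functors and the mix map\<close>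

context isomix_functor
begin

lemma on_simps [simp]:
  "A \<in> Ob S \<Longrightarrow> on_ob F A \<in> Ob C"
  "f \<in> Arr S \<Longrightarrow> on_arr F f \<in> Arr C"
  "f \<in> Arr S \<Longrightarrow> Dom C (on_arr F f) = on_ob F (Dom S f)"
  "f \<in> Arr S \<Longrightarrow> Cod C (on_arr F f) = on_ob F (Cod S f)"
  "A \<in> Ob S \<Longrightarrow> on_arr F (\<one>\<^bsub>S\<^esub> A) = \<one> (on_ob F A)"
  "\<lbrakk>f \<in> Arr S; g \<in> Arr S; Cod S f = Dom S g\<rbrakk> \<Longrightarrow> on_arr F (f \<Zsemi>\<^bsub>S\<^esub> g) = on_arr F f \<Zsemi> on_arr F g"
  using on_ob on_arr on_arr_ide on_arr_cmp by (simp_all add: hom_iff)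

lemma laxity_simps [simp]:
  "\<lbrakk>A \<in> Ob S; B \<in> Ob S\<rbrakk> \<Longrightarrow> m_tensor F A B \<in> Arr C"
  "\<lbrakk>A \<in> Ob S; B \<in> Ob S\<rbrakk> \<Longrightarrow> Dom C (m_tensor F A B) = on_ob F A \<otimes>\<^sub>o on_ob F B"
  "\<lbrakk>A \<in> Ob S; B \<in> Ob S\<rbrakk> \<Longrightarrow> Cod C (m_tensor F A B) = on_ob F (A \<otimes>\<^sub>o\<^bsub>S\<^esub> B)"
  "\<lbrakk>A \<in> Ob S; B \<in> Ob S\<rbrakk> \<Longrightarrow> n_par F A B \<in> Arr C"
  "\<lbrakk>A \<in> Ob S; B \<in> Ob S\<rbrakk> \<Longrightarrow> Dom C (n_par F A B) = on_ob F (A \<oplus>\<^sub>o\<^bsub>S\<^esub> B)"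
  "\<lbrakk>A \<in> Ob S; B \<in> Ob S\<rbrakk> \<Longrightarrow> Cod C (n_par F A B) = on_ob F A \<oplus>\<^sub>o on_ob F B"
  "m_top F \<in> Arr C" "Dom C (m_top F) = \<top>" "Cod C (m_top F) = on_ob F \<top>\<^bsub>S\<^esub>"
  "n_bot F \<in> Arr C" "Dom C (n_bot F) = on_ob F \<bottom>\<^bsub>S\<^esub>" "Cod C (n_bot F) = \<bottom>"
  using m_tensor_hom m_top_hom n_par_hom n_bot_hom by (simp_all add: hom_iff)

lemma m_tensor_natural:
  assumes "f \<in> Arr S" "g \<in> Arr S" "Dom S f = A" "Dom S g = B"
  shows "m_tensor F A B \<Zsemi> on_arr F (f \<otimes>\<^bsub>S\<^esub> g) = (on_arr F f \<otimes> on_arr F g) \<Zsemi> m_tensor F (Cod S f) (Cod S g)"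
  using m_tensor_nat[of f A "Cod S f" g B "Cod S g"] assms by (simp add: hom_iff)

lemma n_par_natural:
  assumes "f \<in> Arr S" "g \<in> Arr S" "Cod S f = A" "Cod S g = B"
  shows "on_arr F (f \<oplus>\<^bsub>S\<^esub> g) \<Zsemi> n_par F A B = n_par F (Dom S f) (Dom S g) \<Zsemi> (on_arr F f \<oplus> on_arr F g)"
  using n_par_nat[of f "Dom S f" A g "Dom S g" B] assms by (simp add: hom_iff)

lemma on_par_lunit_inv:
  assumes A: "A \<in> Ob S"
  shows "on_arr F ((u\<^sup>L\<^sub>\<oplus>\<^bsub>S\<^esub> A)\<^sup>-\<^sup>1\<^bsub>S\<^esub>) \<Zsemi> (n_par F \<bottom>\<^bsub>S\<^esub> A \<Zsemi> (n_bot F \<oplus> \<one> (on_ob F A)))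
    = (u\<^sup>L\<^sub>\<oplus> (on_ob F A))\<^sup>-\<^sup>1"
proof (rule target.tensor.iso_cancel_right[of "u\<^sup>L\<^sub>\<oplus> (on_ob F A)"])
  let ?i = "(u\<^sup>L\<^sub>\<oplus>\<^bsub>S\<^esub> A)\<^sup>-\<^sup>1\<^bsub>S\<^esub>"
  have "(on_arr F ?i \<Zsemi> (n_par F \<bottom>\<^bsub>S\<^esub> A \<Zsemi> (n_bot F \<oplus> \<one> (on_ob F A)))) \<Zsemi> u\<^sup>L\<^sub>\<oplus> (on_ob F A)
      = on_arr F ?i \<Zsemi> (n_par F \<bottom>\<^bsub>S\<^esub> A \<Zsemi> (n_bot F \<oplus> \<one> (on_ob F A)) \<Zsemi> u\<^sup>L\<^sub>\<oplus> (on_ob F A))"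
    using A by simp
  also have "\<dots> = on_arr F (?i \<Zsemi>\<^bsub>S\<^esub> u\<^sup>L\<^sub>\<oplus>\<^bsub>S\<^esub> A)"
    using A unfolding n_lunit[OF A] by (subst on_simps(6)) simp_all
  also have "\<dots> = (u\<^sup>L\<^sub>\<oplus> (on_ob F A))\<^sup>-\<^sup>1 \<Zsemi> u\<^sup>L\<^sub>\<oplus> (on_ob F A)"
    using A by (simp del: on_simps(6))
  finally show "(on_arr F ?i \<Zsemi> (n_par F \<bottom>\<^bsub>S\<^esub> A \<Zsemi> (n_bot F \<oplus> \<one> (on_ob F A)))) \<Zsemi> u\<^sup>L\<^sub>\<oplus> (on_ob F A)
      = (u\<^sup>L\<^sub>\<oplus> (on_ob F A))\<^sup>-\<^sup>1 \<Zsemi> u\<^sup>L\<^sub>\<oplus> (on_ob F A)" .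
qed (use A in simp_all)

text \<open>
  This is where preservation of \<open>\<m>\<close> enters: its factor \<open>n_bot\<close> combines with \<open>n_par\<close> to the unitor,
  and its factor \<open>m_top\<close> is left over, to be used up by the right unit law of \<open>m_tensor\<close>.
\<close>

lemma on_insert_top:
  assumes A: "A \<in> Ob S"
  shows "on_arr F (source.insert_top A) \<Zsemi> n_par F \<top>\<^bsub>S\<^esub> A
    = target.insert_top (on_ob F A) \<Zsemi> (m_top F \<oplus> \<one> (on_ob F A))"
proof -
  have "on_arr F (source.insert_top A) \<Zsemi> n_par F \<top>\<^bsub>S\<^esub> A
      = on_arr F ((u\<^sup>L\<^sub>\<oplus>\<^bsub>S\<^esub> A)\<^sup>-\<^sup>1\<^bsub>S\<^esub>) \<Zsemi> (on_arr F (\<m>\<^bsub>S\<^esub> \<oplus>\<^bsub>S\<^esub> \<one>\<^bsub>S\<^esub> A) \<Zsemi> n_par F \<top>\<^bsub>S\<^esub> A)"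
    using A by (simp add: source.insert_top_def)
  also have "\<dots> = (on_arr F ((u\<^sup>L\<^sub>\<oplus>\<^bsub>S\<^esub> A)\<^sup>-\<^sup>1\<^bsub>S\<^esub>) \<Zsemi> (n_par F \<bottom>\<^bsub>S\<^esub> A \<Zsemi> (n_bot F \<oplus> \<one> (on_ob F A))))
      \<Zsemi> ((\<m> \<Zsemi> m_top F) \<oplus> \<one> (on_ob F A))"
    using A by (simp add: n_par_natural on_mix)
  also have "\<dots> = target.insert_top (on_ob F A) \<Zsemi> (m_top F \<oplus> \<one> (on_ob F A))"
    using A unfolding on_par_lunit_inv[OF A] by (simp add: target.insert_top_def)
  finally show ?thesis .
qed

text \<open>
  The three factors of the mix map are preserved by \<open>on_insert_top\<close>, by the Frobenius condition
  for \<open>\<partial>\<^sup>L\<close>, and by the right unit law of \<open>m_tensor\<close>.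
\<close>

lemma on_mx:
  assumes A: "A \<in> Ob S" and B: "B \<in> Ob S"
  shows "m_tensor F A B \<Zsemi> (on_arr F (mx\<^bsub>S\<^esub> A B) \<Zsemi> n_par F A B) = mx (on_ob F A) (on_ob F B)"
proof -
  let ?A = "on_ob F A" and ?B = "on_ob F B" and ?T = "\<top>\<^bsub>S\<^esub>"
  have "m_tensor F A B \<Zsemi> (on_arr F (mx\<^bsub>S\<^esub> A B) \<Zsemi> n_par F A B)
      = (m_tensor F A B \<Zsemi> on_arr F (\<one>\<^bsub>S\<^esub> A \<otimes>\<^bsub>S\<^esub> source.insert_top B))
        \<Zsemi> (on_arr F (\<partial>\<^sup>L\<^bsub>S\<^esub> A ?T B) \<Zsemi> (on_arr F (u\<^sup>R\<^sub>\<otimes>\<^bsub>S\<^esub> A \<oplus>\<^bsub>S\<^esub> \<one>\<^bsub>S\<^esub> B) \<Zsemi> n_par F A B))"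
    using A B by (simp add: source.mx_eq)
  also have "\<dots> = (\<one> ?A \<otimes> on_arr F (source.insert_top B))
        \<Zsemi> ((m_tensor F A (?T \<oplus>\<^sub>o\<^bsub>S\<^esub> B) \<Zsemi> on_arr F (\<partial>\<^sup>L\<^bsub>S\<^esub> A ?T B) \<Zsemi> n_par F (A \<otimes>\<^sub>o\<^bsub>S\<^esub> ?T) B)
        \<Zsemi> (on_arr F (u\<^sup>R\<^sub>\<otimes>\<^bsub>S\<^esub> A) \<oplus> \<one> ?B))"
    using A B by (simp add: m_tensor_natural n_par_natural)
  also have "\<dots> = (\<one> ?A \<otimes> (on_arr F (source.insert_top B) \<Zsemi> n_par F ?T B))
        \<Zsemi> (\<partial>\<^sup>L ?A (on_ob F ?T) ?B \<Zsemi> ((m_tensor F A ?T \<Zsemi> on_arr F (u\<^sup>R\<^sub>\<otimes>\<^bsub>S\<^esub> A)) \<oplus> \<one> ?B))"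
    using A B by (subst frobenius_ldist) simp_all
  also have "\<dots> = (\<one> ?A \<otimes> target.insert_top ?B)
        \<Zsemi> (((\<one> ?A \<otimes> (m_top F \<oplus> \<one> ?B)) \<Zsemi> \<partial>\<^sup>L ?A (on_ob F ?T) ?B)
        \<Zsemi> ((m_tensor F A ?T \<Zsemi> on_arr F (u\<^sup>R\<^sub>\<otimes>\<^bsub>S\<^esub> A)) \<oplus> \<one> ?B))"
    using A B by (simp add: on_insert_top)
  also have "(\<one> ?A \<otimes> (m_top F \<oplus> \<one> ?B)) \<Zsemi> \<partial>\<^sup>L ?A (on_ob F ?T) ?B
      = \<partial>\<^sup>L ?A \<top> ?B \<Zsemi> ((\<one> ?A \<otimes> m_top F) \<oplus> \<one> ?B)"
    using A B by (simp add: target.ldist_natural)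
  also have "(\<one> ?A \<otimes> target.insert_top ?B)
        \<Zsemi> (\<dots> \<Zsemi> ((m_tensor F A ?T \<Zsemi> on_arr F (u\<^sup>R\<^sub>\<otimes>\<^bsub>S\<^esub> A)) \<oplus> \<one> ?B))
      = (\<one> ?A \<otimes> target.insert_top ?B)
        \<Zsemi> (\<partial>\<^sup>L ?A \<top> ?B \<Zsemi> (((\<one> ?A \<otimes> m_top F) \<Zsemi> m_tensor F A ?T \<Zsemi> on_arr F (u\<^sup>R\<^sub>\<otimes>\<^bsub>S\<^esub> A)) \<oplus> \<one> ?B))"
    using A B by simp
  also have "\<dots> = mx ?A ?B"
    using A B by (simp only: m_runit target.mx_eq on_simps)
  finally show ?thesis .
qed

end

section \<open>Kraus maps\<close>

context mixed_unitary_category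
begin

lemma preservator_simps [simp]:
  assumes "V \<in> Ob U"
  shows "preservator M V \<in> Arr C" "Dom C (preservator M V) = on_ob M (V\<^sup>\<dagger>\<^sub>o\<^bsub>U\<^esub>)"
    "Cod C (preservator M V) = (on_ob M V)\<^sup>\<dagger>\<^sub>o"
  using preservator_iso[OF assms] by (auto simp: iso_def hom_iff)

lemma strong_simps [simp]:
  "\<lbrakk>V \<in> Ob U; W \<in> Ob U\<rbrakk> \<Longrightarrow> n_par M V W \<in> iso C (on_ob M (V \<oplus>\<^sub>o\<^bsub>U\<^esub> W)) (on_ob M V \<oplus>\<^sub>o on_ob M W)"
  "n_bot M \<in> iso C (on_ob M \<bottom>\<^bsub>U\<^esub>) \<bottom>"
  "\<lbrakk>V \<in> Ob U; X \<in> Ob C\<rbrakk> \<Longrightarrow> mx (on_ob M V) X \<in> iso C (on_ob M V \<otimes>\<^sub>o X) (on_ob M V \<oplus>\<^sub>o X)"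
  using n_par_iso n_bot_iso on_ob_core by (auto simp: core_def)

definition form :: "'uo \<Rightarrow> 'cm" where
  "form V = on_arr M (\<phi>\<^bsub>U\<^esub> V) \<Zsemi> preservator M V"

definition square :: "'uo \<Rightarrow> 'cm \<Rightarrow> 'cm" where
  "square V k = k \<Zsemi> (form V \<Zsemi> k\<^sup>\<dagger>)"

lemma form_simps [simp]:
  assumes "V \<in> Ob U"
  shows "form V \<in> Arr C" "Dom C (form V) = on_ob M V" "Cod C (form V) = (on_ob M V)\<^sup>\<dagger>\<^sub>o"
  using assms by (simp_all add: form_def)

lemma square_simps [simp]:
  assumes "V \<in> Ob U" "k \<in> Arr C" "Cod C k = on_ob M V"
  shows "square V k \<in> Arr C" "Dom C (square V k) = Dom C k" "Cod C (square V k) = (Dom C k)\<^sup>\<dagger>\<^sub>o"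
  using assms by (simp_all add: square_def)

text \<open>
  The middle of a test is the form of the merged ancilla, conjugated by \<open>n_par\<close>: the functor
  carries the formula for \<open>\<phi>\<close> on a par to \<open>form\<close>, because it preserves mix maps and its
  preservator respects \<open>\<lambda>\<^sub>\<otimes>\<close>.
\<close>

lemma form_par:
  assumes V: "V \<in> Ob U" and W: "W \<in> Ob U"
  shows "(mx (on_ob M V) (on_ob M W))\<^sup>-\<^sup>1 \<Zsemi> ((form V \<otimes> form W) \<Zsemi> \<lambda>\<^sub>\<otimes> (on_ob M V) (on_ob M W))
    = (n_par M V W)\<^sup>-\<^sup>1 \<Zsemi> (form (V \<oplus>\<^sub>o\<^bsub>U\<^esub> W) \<Zsemi> ((n_par M V W)\<^sup>-\<^sup>1)\<^sup>\<dagger>)"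
proof -
  let ?V = "on_ob M V" and ?W = "on_ob M W" and ?n = "n_par M V W"
  have n_dagger: "?n\<^sup>\<dagger> \<Zsemi> (?n\<^sup>-\<^sup>1)\<^sup>\<dagger> = \<one> ((?V \<oplus>\<^sub>o ?W)\<^sup>\<dagger>\<^sub>o)"
    using V W target.dagger_simps(6)[of "?n\<^sup>-\<^sup>1" ?n, symmetric] by simp
  have mx: "m_tensor M V W \<Zsemi> on_arr M (mx\<^bsub>U\<^esub> V W) = mx ?V ?W \<Zsemi> ?n\<^sup>-\<^sup>1"
    by (rule target.tensor.iso_cancel_right[of ?n]) (use V W in \<open>simp_all add: on_mx\<close>)
  have "(form V \<otimes> form W) \<Zsemi> (\<lambda>\<^sub>\<otimes> ?V ?W \<Zsemi> ?n\<^sup>\<dagger>)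
      = (on_arr M (\<phi>\<^bsub>U\<^esub> V) \<otimes> on_arr M (\<phi>\<^bsub>U\<^esub> W))
        \<Zsemi> ((preservator M V \<otimes> preservator M W) \<Zsemi> \<lambda>\<^sub>\<otimes> ?V ?W \<Zsemi> ?n\<^sup>\<dagger>)"
    using V W by (simp add: form_def)
  also have "\<dots> = ((on_arr M (\<phi>\<^bsub>U\<^esub> V) \<otimes> on_arr M (\<phi>\<^bsub>U\<^esub> W)) \<Zsemi> m_tensor M (V\<^sup>\<dagger>\<^sub>o\<^bsub>U\<^esub>) (W\<^sup>\<dagger>\<^sub>o\<^bsub>U\<^esub>))
        \<Zsemi> (on_arr M (\<lambda>\<^sub>\<otimes>\<^bsub>U\<^esub> V W) \<Zsemi> preservator M (V \<oplus>\<^sub>o\<^bsub>U\<^esub> W))"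
    using V W by (subst preservator_lam_tensor[symmetric]) simp_all
  also have "\<dots> = m_tensor M V W \<Zsemi> (on_arr M ((\<phi>\<^bsub>U\<^esub> V \<otimes>\<^bsub>U\<^esub> \<phi>\<^bsub>U\<^esub> W) \<Zsemi>\<^bsub>U\<^esub> \<lambda>\<^sub>\<otimes>\<^bsub>U\<^esub> V W)
        \<Zsemi> preservator M (V \<oplus>\<^sub>o\<^bsub>U\<^esub> W))"
    using V W m_tensor_natural[of "\<phi>\<^bsub>U\<^esub> V" "\<phi>\<^bsub>U\<^esub> W" V W, symmetric] by simp
  also have "\<dots> = (m_tensor M V W \<Zsemi> on_arr M (mx\<^bsub>U\<^esub> V W)) \<Zsemi> form (V \<oplus>\<^sub>o\<^bsub>U\<^esub> W)"
    using V W by (simp add: source.mx_ustruct_par[symmetric] form_def)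
  also have "\<dots> = mx ?V ?W \<Zsemi> (?n\<^sup>-\<^sup>1 \<Zsemi> form (V \<oplus>\<^sub>o\<^bsub>U\<^esub> W))"
    using V W unfolding mx by simp
  finally have eq: "(form V \<otimes> form W) \<Zsemi> (\<lambda>\<^sub>\<otimes> ?V ?W \<Zsemi> ?n\<^sup>\<dagger>) = mx ?V ?W \<Zsemi> (?n\<^sup>-\<^sup>1 \<Zsemi> form (V \<oplus>\<^sub>o\<^bsub>U\<^esub> W))" .
  have "(form V \<otimes> form W) \<Zsemi> \<lambda>\<^sub>\<otimes> ?V ?W = (form V \<otimes> form W) \<Zsemi> (\<lambda>\<^sub>\<otimes> ?V ?W \<Zsemi> (?n\<^sup>\<dagger> \<Zsemi> (?n\<^sup>-\<^sup>1)\<^sup>\<dagger>))"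
    using V W unfolding n_dagger by simp
  also have "\<dots> = ((form V \<otimes> form W) \<Zsemi> (\<lambda>\<^sub>\<otimes> ?V ?W \<Zsemi> ?n\<^sup>\<dagger>)) \<Zsemi> (?n\<^sup>-\<^sup>1)\<^sup>\<dagger>"
    using V W by simp
  also have "\<dots> = mx ?V ?W \<Zsemi> (?n\<^sup>-\<^sup>1 \<Zsemi> (form (V \<oplus>\<^sub>o\<^bsub>U\<^esub> W) \<Zsemi> (?n\<^sup>-\<^sup>1)\<^sup>\<dagger>))"
    using V W unfolding eq by simp
  finally show ?thesis
    using V W by simp
qed

lemma square_unitary:
  assumes w: "source.unitary V W w" and V: "V \<in> Ob U" and W: "W \<in> Ob U"
    and k: "k \<in> Arr C" "Cod C k = on_ob M V"
  shows "square W (k \<Zsemi> on_arr M w) = square V k"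
proof -
  have w_arr: "w \<in> Arr U" "Dom U w = V" "Cod U w = W" and eq: "w \<Zsemi>\<^bsub>U\<^esub> (\<phi>\<^bsub>U\<^esub> W \<Zsemi>\<^bsub>U\<^esub> w\<^sup>\<dagger>\<^bsub>U\<^esub>) = \<phi>\<^bsub>U\<^esub> V"
    using w by (auto simp: source.unitary_def hom_iff)
  have \<rho>: "preservator M W \<Zsemi> (on_arr M w)\<^sup>\<dagger> = on_arr M (w\<^sup>\<dagger>\<^bsub>U\<^esub>) \<Zsemi> preservator M V"
    using preservator_nat[of w V W] w_arr by (simp add: hom_iff)
  have "on_arr M w \<Zsemi> (form W \<Zsemi> (on_arr M w)\<^sup>\<dagger>) = on_arr M (w \<Zsemi>\<^bsub>U\<^esub> (\<phi>\<^bsub>U\<^esub> W \<Zsemi>\<^bsub>U\<^esub> w\<^sup>\<dagger>\<^bsub>U\<^esub>)) \<Zsemi> preservator M V"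
    using w_arr V W \<rho> by (simp add: form_def)
  then have "on_arr M w \<Zsemi> (form W \<Zsemi> (on_arr M w)\<^sup>\<dagger>) = form V"
    unfolding eq by (simp add: form_def)
  moreover have "square W (k \<Zsemi> on_arr M w) = k \<Zsemi> ((on_arr M w \<Zsemi> (form W \<Zsemi> (on_arr M w)\<^sup>\<dagger>)) \<Zsemi> k\<^sup>\<dagger>)"
    using k w_arr V W by (simp add: square_def)
  ultimately show ?thesis
    by (simp add: square_def)
qed

text \<open>
  A Kraus map followed by an effect \<open>h : B \<otimes> D \<rightarrow> M W\<close> is an effect on \<open>A \<otimes> D\<close>, whose ancilla is
  the par of both ancillas.
\<close>

definition absorb :: "'co \<Rightarrow> 'co \<Rightarrow> 'uo \<Rightarrow> 'cm \<Rightarrow> 'cm \<times> 'uo \<Rightarrow> 'cm" where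
  "absorb B D W h = (\<lambda>(f, V). (f \<otimes> \<one> D)
     \<Zsemi> (\<partial>\<^sup>R (on_ob M V) B D \<Zsemi> ((\<one> (on_ob M V) \<oplus> h) \<Zsemi> (n_par M V W)\<^sup>-\<^sup>1)))"

text \<open>
  The action of a Kraus map on an arrow \<open>t : B \<otimes> D \<rightarrow> (B \<otimes> D)\<^sup>\<dagger>\<close>, such as the square of an effect or
  a test of a further Kraus map.
\<close>

definition surround :: "'co \<Rightarrow> 'co \<Rightarrow> 'cm \<Rightarrow> 'cm \<times> 'uo \<Rightarrow> 'cm" where
  "surround B D t = (\<lambda>(f, V). (f \<otimes> \<one> D) \<Zsemi> (\<partial>\<^sup>R (on_ob M V) B D
     \<Zsemi> ((mx (on_ob M V) (B \<otimes>\<^sub>o D))\<^sup>-\<^sup>1 \<Zsemi> ((form V \<otimes> t)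
     \<Zsemi> (\<lambda>\<^sub>\<otimes> (on_ob M V) (B \<otimes>\<^sub>o D) \<Zsemi> ((\<partial>\<^sup>R (on_ob M V) B D)\<^sup>\<dagger> \<Zsemi> (f \<otimes> \<one> D)\<^sup>\<dagger>))))))"

lemma absorb_hom:
  assumes "V \<in> Ob U" "W \<in> Ob U" "B \<in> Ob C" "D \<in> Ob C"
    and "f \<in> hom C A (on_ob M V \<oplus>\<^sub>o B)" "h \<in> hom C (B \<otimes>\<^sub>o D) (on_ob M W)"
  shows "absorb B D W h (f, V) \<in> hom C (A \<otimes>\<^sub>o D) (on_ob M (V \<oplus>\<^sub>o\<^bsub>U\<^esub> W))"
  using assms by (simp add: absorb_def hom_iff)

text \<open>
  The mix map at \<open>M V\<close> is invertible for every second argument, so \<open>h\<close> passes through its inverse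
  by naturality and meets its dagger in the second tensor factor.
\<close>

lemma mix_form_conjugate:
  assumes V: "V \<in> Ob U" and W: "W \<in> Ob U" and h: "h \<in> Arr C" "Dom C h = X" "Cod C h = on_ob M W"
  shows "(\<one> (on_ob M V) \<oplus> h) \<Zsemi> ((mx (on_ob M V) (on_ob M W))\<^sup>-\<^sup>1
      \<Zsemi> ((form V \<otimes> form W) \<Zsemi> (\<lambda>\<^sub>\<otimes> (on_ob M V) (on_ob M W) \<Zsemi> (\<one> (on_ob M V) \<oplus> h)\<^sup>\<dagger>)))
    = (mx (on_ob M V) X)\<^sup>-\<^sup>1 \<Zsemi> ((form V \<otimes> square W h) \<Zsemi> \<lambda>\<^sub>\<otimes> (on_ob M V) X)"
proof -
  let ?V = "on_ob M V" and ?W = "on_ob M W"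
  have X: "X \<in> Ob C" using h by auto
  have mx: "(\<one> ?V \<oplus> h) \<Zsemi> (mx ?V ?W)\<^sup>-\<^sup>1 = (mx ?V X)\<^sup>-\<^sup>1 \<Zsemi> (\<one> ?V \<otimes> h)"
  proof (rule target.tensor.iso_cancel_left[of "mx ?V X"])
    have "mx ?V X \<Zsemi> ((\<one> ?V \<oplus> h) \<Zsemi> (mx ?V ?W)\<^sup>-\<^sup>1) = (mx ?V X \<Zsemi> (\<one> ?V \<oplus> h)) \<Zsemi> (mx ?V ?W)\<^sup>-\<^sup>1"
      using V W h X by simp
    also have "\<dots> = \<one> ?V \<otimes> h"
      using V W h X by (simp add: target.mx_natural)
    finally show "mx ?V X \<Zsemi> ((\<one> ?V \<oplus> h) \<Zsemi> (mx ?V ?W)\<^sup>-\<^sup>1) = mx ?V X \<Zsemi> ((mx ?V X)\<^sup>-\<^sup>1 \<Zsemi> (\<one> ?V \<otimes> h))"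
      using V W h X by simp
  qed (use V W h X in simp_all)
  have "(\<one> ?V \<oplus> h) \<Zsemi> ((mx ?V ?W)\<^sup>-\<^sup>1 \<Zsemi> ((form V \<otimes> form W) \<Zsemi> (\<lambda>\<^sub>\<otimes> ?V ?W \<Zsemi> (\<one> ?V \<oplus> h)\<^sup>\<dagger>)))
      = ((\<one> ?V \<oplus> h) \<Zsemi> (mx ?V ?W)\<^sup>-\<^sup>1) \<Zsemi> ((form V \<otimes> form W) \<Zsemi> ((\<one> (?V\<^sup>\<dagger>\<^sub>o) \<otimes> h\<^sup>\<dagger>) \<Zsemi> \<lambda>\<^sub>\<otimes> ?V X))"
    using V W h X by (simp add: target.lam_tensor_natural)
  also have "\<dots> = (mx ?V X)\<^sup>-\<^sup>1 \<Zsemi> ((form V \<otimes> square W h) \<Zsemi> \<lambda>\<^sub>\<otimes> ?V X)"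
    using V W h X unfolding mx by (simp add: square_def)
  finally show ?thesis .
qed

text \<open>
  Up to \<open>\<lambda>\<^sub>\<otimes>\<close>, the second half of a test is the dagger of the first half: the axiom relating \<open>\<partial>\<^sup>L\<close>, \<open>\<lambda>\<^sub>\<otimes>\<close>
  and \<open>\<lambda>\<^sub>\<oplus>\<close> to \<open>(\<partial>\<^sup>R)\<^sup>\<dagger>\<close> removes \<open>\<lambda>\<^sub>\<oplus>\<close> and its inverse.
\<close>

lemma kraus_test_core:
  assumes V: "V \<in> Ob U" and W: "W \<in> Ob U" and B: "B \<in> Ob C" and D: "D \<in> Ob C"
    and f: "f \<in> Arr C" "Dom C f = A" "Cod C f = on_ob M V \<oplus>\<^sub>o B"
    and h: "h \<in> Arr C" "Dom C h = B \<otimes>\<^sub>o D" "Cod C h = on_ob M W"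
  shows "kraus_test U C M A B D W h (f, V) = (f \<otimes> \<one> D) \<Zsemi> (\<partial>\<^sup>R (on_ob M V) B D
    \<Zsemi> (((\<one> (on_ob M V) \<oplus> h) \<Zsemi> ((mx (on_ob M V) (on_ob M W))\<^sup>-\<^sup>1
      \<Zsemi> ((form V \<otimes> form W) \<Zsemi> (\<lambda>\<^sub>\<otimes> (on_ob M V) (on_ob M W) \<Zsemi> (\<one> (on_ob M V) \<oplus> h)\<^sup>\<dagger>))))
    \<Zsemi> ((\<partial>\<^sup>R (on_ob M V) B D)\<^sup>\<dagger> \<Zsemi> (f \<otimes> \<one> D)\<^sup>\<dagger>)))"
proof -
  let ?V = "on_ob M V" and ?W = "on_ob M W"
  have A: "A \<in> Ob C" using f by auto
  have "(\<one> (?V\<^sup>\<dagger>\<^sub>o) \<otimes> (h\<^sup>\<dagger> \<Zsemi> (\<lambda>\<^sub>\<oplus> B D)\<^sup>-\<^sup>1)) \<Zsemi> (\<partial>\<^sup>L (?V\<^sup>\<dagger>\<^sub>o) (B\<^sup>\<dagger>\<^sub>o) (D\<^sup>\<dagger>\<^sub>o)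
        \<Zsemi> ((\<lambda>\<^sub>\<otimes> ?V B \<oplus> \<one> (D\<^sup>\<dagger>\<^sub>o)) \<Zsemi> ((f\<^sup>\<dagger> \<oplus> \<one> (D\<^sup>\<dagger>\<^sub>o)) \<Zsemi> \<lambda>\<^sub>\<oplus> A D)))
      = (\<one> (?V\<^sup>\<dagger>\<^sub>o) \<otimes> (h\<^sup>\<dagger> \<Zsemi> (\<lambda>\<^sub>\<oplus> B D)\<^sup>-\<^sup>1)) \<Zsemi> (\<partial>\<^sup>L (?V\<^sup>\<dagger>\<^sub>o) (B\<^sup>\<dagger>\<^sub>o) (D\<^sup>\<dagger>\<^sub>o)
        \<Zsemi> (\<lambda>\<^sub>\<otimes> ?V B \<oplus> \<one> (D\<^sup>\<dagger>\<^sub>o)) \<Zsemi> \<lambda>\<^sub>\<oplus> (?V \<oplus>\<^sub>o B) D) \<Zsemi> (f \<otimes> \<one> D)\<^sup>\<dagger>"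
    using V W B D f h A by (simp add: target.lam_par_natural del: target.par.interchange_prefix)
  also have "\<dots> = (\<one> (?V\<^sup>\<dagger>\<^sub>o) \<otimes> h\<^sup>\<dagger>) \<Zsemi> (\<lambda>\<^sub>\<otimes> ?V (B \<otimes>\<^sub>o D) \<Zsemi> ((\<partial>\<^sup>R ?V B D)\<^sup>\<dagger> \<Zsemi> (f \<otimes> \<one> D)\<^sup>\<dagger>))"
    using V W B D f h A by (simp only: target.lam_ldist on_simps) simp
  also have "\<dots> = \<lambda>\<^sub>\<otimes> ?V ?W \<Zsemi> ((\<one> ?V \<oplus> h)\<^sup>\<dagger> \<Zsemi> ((\<partial>\<^sup>R ?V B D)\<^sup>\<dagger> \<Zsemi> (f \<otimes> \<one> D)\<^sup>\<dagger>))"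
    using V W B D f h A by (simp add: target.tensor.cmp_prefix[OF target.lam_tensor_natural])
  finally have tail: "(\<one> (?V\<^sup>\<dagger>\<^sub>o) \<otimes> (h\<^sup>\<dagger> \<Zsemi> (\<lambda>\<^sub>\<oplus> B D)\<^sup>-\<^sup>1)) \<Zsemi> (\<partial>\<^sup>L (?V\<^sup>\<dagger>\<^sub>o) (B\<^sup>\<dagger>\<^sub>o) (D\<^sup>\<dagger>\<^sub>o)
        \<Zsemi> ((\<lambda>\<^sub>\<otimes> ?V B \<oplus> \<one> (D\<^sup>\<dagger>\<^sub>o)) \<Zsemi> ((f\<^sup>\<dagger> \<oplus> \<one> (D\<^sup>\<dagger>\<^sub>o)) \<Zsemi> \<lambda>\<^sub>\<oplus> A D)))
      = \<lambda>\<^sub>\<otimes> ?V ?W \<Zsemi> ((\<one> ?V \<oplus> h)\<^sup>\<dagger> \<Zsemi> ((\<partial>\<^sup>R ?V B D)\<^sup>\<dagger> \<Zsemi> (f \<otimes> \<one> D)\<^sup>\<dagger>))" .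
  \<comment> \<open>the factors are made opaque, since the typing conditions for rebracketing a composite
    grow exponentially with its length\<close>
  define head where "head = (f \<otimes> \<one> D) \<Zsemi> \<partial>\<^sup>R ?V B D \<Zsemi> (\<one> ?V \<oplus> h) \<Zsemi> (mx ?V ?W)\<^sup>-\<^sup>1"
  define t1 where "t1 = \<one> (?V\<^sup>\<dagger>\<^sub>o) \<otimes> (h\<^sup>\<dagger> \<Zsemi> (\<lambda>\<^sub>\<oplus> B D)\<^sup>-\<^sup>1)"
  define t2 where "t2 = \<partial>\<^sup>L (?V\<^sup>\<dagger>\<^sub>o) (B\<^sup>\<dagger>\<^sub>o) (D\<^sup>\<dagger>\<^sub>o)"
  define t3 where "t3 = \<lambda>\<^sub>\<otimes> ?V B \<oplus> \<one> (D\<^sup>\<dagger>\<^sub>o)"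
  define t4 where "t4 = f\<^sup>\<dagger> \<oplus> \<one> (D\<^sup>\<dagger>\<^sub>o)"
  have head: "head \<in> Arr C" "Cod C head = ?V \<otimes>\<^sub>o ?W"
    and t1: "t1 \<in> Arr C" "Dom C t1 = ?V\<^sup>\<dagger>\<^sub>o \<otimes>\<^sub>o ?W\<^sup>\<dagger>\<^sub>o" "Cod C t1 = ?V\<^sup>\<dagger>\<^sub>o \<otimes>\<^sub>o (B\<^sup>\<dagger>\<^sub>o \<oplus>\<^sub>o D\<^sup>\<dagger>\<^sub>o)"
    and t2: "t2 \<in> Arr C" "Dom C t2 = ?V\<^sup>\<dagger>\<^sub>o \<otimes>\<^sub>o (B\<^sup>\<dagger>\<^sub>o \<oplus>\<^sub>o D\<^sup>\<dagger>\<^sub>o)" "Cod C t2 = (?V\<^sup>\<dagger>\<^sub>o \<otimes>\<^sub>o B\<^sup>\<dagger>\<^sub>o) \<oplus>\<^sub>o D\<^sup>\<dagger>\<^sub>o"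
    and t3: "t3 \<in> Arr C" "Dom C t3 = (?V\<^sup>\<dagger>\<^sub>o \<otimes>\<^sub>o B\<^sup>\<dagger>\<^sub>o) \<oplus>\<^sub>o D\<^sup>\<dagger>\<^sub>o" "Cod C t3 = (?V \<oplus>\<^sub>o B)\<^sup>\<dagger>\<^sub>o \<oplus>\<^sub>o D\<^sup>\<dagger>\<^sub>o"
    and t4: "t4 \<in> Arr C" "Dom C t4 = (?V \<oplus>\<^sub>o B)\<^sup>\<dagger>\<^sub>o \<oplus>\<^sub>o D\<^sup>\<dagger>\<^sub>o" "Cod C t4 = A\<^sup>\<dagger>\<^sub>o \<oplus>\<^sub>o D\<^sup>\<dagger>\<^sub>o"
    using V W B D f h A by (simp_all add: head_def t1_def t2_def t3_def t4_def)
  have forms: "head \<Zsemi> (on_arr M (\<phi>\<^bsub>U\<^esub> V) \<otimes> on_arr M (\<phi>\<^bsub>U\<^esub> W)) \<Zsemi> (preservator M V \<otimes> preservator M W)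
      = head \<Zsemi> (form V \<otimes> form W)"
    using V W head by (simp add: form_def)
  have "kraus_test U C M A B D W h (f, V)
      = head \<Zsemi> (on_arr M (\<phi>\<^bsub>U\<^esub> V) \<otimes> on_arr M (\<phi>\<^bsub>U\<^esub> W)) \<Zsemi> (preservator M V \<otimes> preservator M W)
        \<Zsemi> t1 \<Zsemi> t2 \<Zsemi> t3 \<Zsemi> t4 \<Zsemi> \<lambda>\<^sub>\<oplus> A D"
    by (simp only: kraus_test_def prod.case head_def t1_def t2_def t3_def t4_def)
  also have "\<dots> = (head \<Zsemi> (form V \<otimes> form W)) \<Zsemi> (t1 \<Zsemi> (t2 \<Zsemi> (t3 \<Zsemi> (t4 \<Zsemi> \<lambda>\<^sub>\<oplus> A D))))"
    unfolding forms using V W A D head t1 t2 t3 t4 by simp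
  also have "t1 \<Zsemi> (t2 \<Zsemi> (t3 \<Zsemi> (t4 \<Zsemi> \<lambda>\<^sub>\<oplus> A D)))
      = \<lambda>\<^sub>\<otimes> ?V ?W \<Zsemi> ((\<one> ?V \<oplus> h)\<^sup>\<dagger> \<Zsemi> ((\<partial>\<^sup>R ?V B D)\<^sup>\<dagger> \<Zsemi> (f \<otimes> \<one> D)\<^sup>\<dagger>))"
    unfolding t1_def t2_def t3_def t4_def by (rule tail)
  finally show ?thesis
    using V W B D f h A by (simp add: head_def)
qed

lemma kraus_test_eq_square:
  assumes V: "V \<in> Ob U" and W: "W \<in> Ob U" and B: "B \<in> Ob C" and D: "D \<in> Ob C"
    and f: "f \<in> hom C A (on_ob M V \<oplus>\<^sub>o B)" and h: "h \<in> hom C (B \<otimes>\<^sub>o D) (on_ob M W)"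
  shows "kraus_test U C M A B D W h (f, V) = square (V \<oplus>\<^sub>o\<^bsub>U\<^esub> W) (absorb B D W h (f, V))"
proof -
  let ?V = "on_ob M V" and ?W = "on_ob M W" and ?n = "n_par M V W"
  note ob = V W B D
  have arr: "f \<in> Arr C" "Dom C f = A" "Cod C f = ?V \<oplus>\<^sub>o B" "h \<in> Arr C" "Dom C h = B \<otimes>\<^sub>o D" "Cod C h = ?W"
    using f h by (auto simp: hom_iff)
  have "kraus_test U C M A B D W h (f, V) = (f \<otimes> \<one> D) \<Zsemi> (\<partial>\<^sup>R ?V B D \<Zsemi> ((\<one> ?V \<oplus> h)
      \<Zsemi> (((mx ?V ?W)\<^sup>-\<^sup>1 \<Zsemi> ((form V \<otimes> form W) \<Zsemi> \<lambda>\<^sub>\<otimes> ?V ?W))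
      \<Zsemi> ((\<one> ?V \<oplus> h)\<^sup>\<dagger> \<Zsemi> ((\<partial>\<^sup>R ?V B D)\<^sup>\<dagger> \<Zsemi> (f \<otimes> \<one> D)\<^sup>\<dagger>)))))"
    using ob arr by (simp add: kraus_test_core)
  also have "\<dots> = square (V \<oplus>\<^sub>o\<^bsub>U\<^esub> W) (absorb B D W h (f, V))"
    using ob arr unfolding form_par[OF V W] by (simp add: square_def absorb_def)
  finally show ?thesis .
qed

lemma kraus_test_eq_surround:
  assumes V: "V \<in> Ob U" and W: "W \<in> Ob U" and B: "B \<in> Ob C" and D: "D \<in> Ob C"
    and f: "f \<in> hom C A (on_ob M V \<oplus>\<^sub>o B)" and h: "h \<in> hom C (B \<otimes>\<^sub>o D) (on_ob M W)"
  shows "kraus_test U C M A B D W h (f, V) = surround B D (square W h) (f, V)"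
proof -
  have arr: "f \<in> Arr C" "Dom C f = A" "Cod C f = on_ob M V \<oplus>\<^sub>o B"
      "h \<in> Arr C" "Dom C h = B \<otimes>\<^sub>o D" "Cod C h = on_ob M W"
    using f h by (auto simp: hom_iff)
  show ?thesis
    unfolding kraus_test_core[OF V W B D arr] mix_form_conjugate[OF V W arr(4-6)]
    using V W B D arr by (simp add: surround_def)
qed

text \<open>
  Comonoidality read backwards: merging three ancillas in either order differs by the image of
  the associator.
\<close>

lemma n_par_assoc_inv:
  assumes V: "V \<in> Ob U" and W: "W \<in> Ob U" and X: "X \<in> Ob U"
  shows "a\<^sub>\<oplus> (on_ob M V) (on_ob M W) (on_ob M X)
      \<Zsemi> (((n_par M V W)\<^sup>-\<^sup>1 \<oplus> \<one> (on_ob M X)) \<Zsemi> (n_par M (V \<oplus>\<^sub>o\<^bsub>U\<^esub> W) X)\<^sup>-\<^sup>1)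
    = (\<one> (on_ob M V) \<oplus> (n_par M W X)\<^sup>-\<^sup>1)
      \<Zsemi> ((n_par M V (W \<oplus>\<^sub>o\<^bsub>U\<^esub> X))\<^sup>-\<^sup>1 \<Zsemi> on_arr M (a\<^sub>\<oplus>\<^bsub>U\<^esub> V W X))"
    (is "?l = ?r")
proof -
  let ?n = "n_par M V (W \<oplus>\<^sub>o\<^bsub>U\<^esub> X)" and ?n' = "\<one> (on_ob M V) \<oplus> n_par M W X"
  have "?n \<Zsemi> (?n' \<Zsemi> ?l) = (?n \<Zsemi> ?n' \<Zsemi> a\<^sub>\<oplus> (on_ob M V) (on_ob M W) (on_ob M X))
      \<Zsemi> (((n_par M V W)\<^sup>-\<^sup>1 \<oplus> \<one> (on_ob M X)) \<Zsemi> (n_par M (V \<oplus>\<^sub>o\<^bsub>U\<^esub> W) X)\<^sup>-\<^sup>1)"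
    using V W X by simp
  also have "\<dots> = on_arr M (a\<^sub>\<oplus>\<^bsub>U\<^esub> V W X)"
    using V W X unfolding n_assoc[OF V W X] by simp
  also have "\<dots> = ?n \<Zsemi> (?n' \<Zsemi> ?r)"
    using V W X by simp
  finally have "?n' \<Zsemi> ?l = ?n' \<Zsemi> ?r"
    using V W X by - (rule target.tensor.iso_cancel_left[of ?n], simp_all)
  then show ?thesis
    using V W X by - (rule target.tensor.iso_cancel_left[of ?n'], simp_all)
qed

text \<open>
  The associator in the composite of Kraus maps is moved through \<open>\<partial>\<^sup>R\<close>, past \<open>g\<close> and \<open>h\<close>, until it
  reaches the ancillas, where it becomes the image of an associator of the unitary category.
\<close>

lemma absorb_comp:
  assumes V: "V \<in> Ob U" and W: "W \<in> Ob U" and X: "X \<in> Ob U"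
    and B: "B \<in> Ob C" and D: "D \<in> Ob C" and E: "E \<in> Ob C"
    and f: "f \<in> hom C A (on_ob M V \<oplus>\<^sub>o B)" and g: "g \<in> hom C B (on_ob M W \<oplus>\<^sub>o D)"
    and h: "h \<in> hom C (D \<otimes>\<^sub>o E) (on_ob M X)"
  shows "absorb D E X h (kraus_comp U C M D (f, V) (g, W))
    = absorb B E (W \<oplus>\<^sub>o\<^bsub>U\<^esub> X) (absorb D E X h (g, W)) (f, V) \<Zsemi> on_arr M (a\<^sub>\<oplus>\<^bsub>U\<^esub> V W X)"
proof -
  let ?V = "on_ob M V" and ?W = "on_ob M W" and ?X = "on_ob M X" and ?VW = "on_ob M (V \<oplus>\<^sub>o\<^bsub>U\<^esub> W)"
  let ?n = "(n_par M V W)\<^sup>-\<^sup>1" and ?n' = "(n_par M (V \<oplus>\<^sub>o\<^bsub>U\<^esub> W) X)\<^sup>-\<^sup>1"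
  note ob = V W X B D E
  have arr: "f \<in> Arr C" "Dom C f = A" "Cod C f = ?V \<oplus>\<^sub>o B"
      "g \<in> Arr C" "Dom C g = B" "Cod C g = ?W \<oplus>\<^sub>o D"
      "h \<in> Arr C" "Dom C h = D \<otimes>\<^sub>o E" "Cod C h = ?X"
    using f g h by (auto simp: hom_iff)
  have "absorb D E X h (kraus_comp U C M D (f, V) (g, W))
      = (f \<otimes> \<one> E) \<Zsemi> (((\<one> ?V \<oplus> g) \<otimes> \<one> E) \<Zsemi> ((a\<^sub>\<oplus> ?V ?W D \<otimes> \<one> E)
        \<Zsemi> ((((?n \<oplus> \<one> D) \<otimes> \<one> E) \<Zsemi> \<partial>\<^sup>R ?VW D E) \<Zsemi> ((\<one> ?VW \<oplus> h) \<Zsemi> ?n'))))"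
    using ob arr by (simp add: absorb_def kraus_comp_def)
  also have "((?n \<oplus> \<one> D) \<otimes> \<one> E) \<Zsemi> \<partial>\<^sup>R ?VW D E = \<partial>\<^sup>R (?V \<oplus>\<^sub>o ?W) D E \<Zsemi> (?n \<oplus> (\<one> D \<otimes> \<one> E))"
    using ob by (subst target.rdist_natural) simp_all
  also have "(a\<^sub>\<oplus> ?V ?W D \<otimes> \<one> E) \<Zsemi> ((\<partial>\<^sup>R (?V \<oplus>\<^sub>o ?W) D E \<Zsemi> (?n \<oplus> (\<one> D \<otimes> \<one> E))) \<Zsemi> ((\<one> ?VW \<oplus> h) \<Zsemi> ?n'))
      = ((a\<^sub>\<oplus> ?V ?W D \<otimes> \<one> E) \<Zsemi> \<partial>\<^sup>R (?V \<oplus>\<^sub>o ?W) D E) \<Zsemi> ((?n \<oplus> h) \<Zsemi> ?n')"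
    using ob arr by simp
  also have "(a\<^sub>\<oplus> ?V ?W D \<otimes> \<one> E) \<Zsemi> \<partial>\<^sup>R (?V \<oplus>\<^sub>o ?W) D E
      = \<partial>\<^sup>R ?V (?W \<oplus>\<^sub>o D) E \<Zsemi> (\<one> ?V \<oplus> \<partial>\<^sup>R ?W D E) \<Zsemi> a\<^sub>\<oplus> ?V ?W (D \<otimes>\<^sub>o E)"
    using ob by (simp only: target.rdist_par_assoc on_simps)
  also have "((\<one> ?V \<oplus> g) \<otimes> \<one> E) \<Zsemi> (\<dots> \<Zsemi> ((?n \<oplus> h) \<Zsemi> ?n'))
      = (((\<one> ?V \<oplus> g) \<otimes> \<one> E) \<Zsemi> \<partial>\<^sup>R ?V (?W \<oplus>\<^sub>o D) E) \<Zsemi> ((\<one> ?V \<oplus> \<partial>\<^sup>R ?W D E)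
        \<Zsemi> ((a\<^sub>\<oplus> ?V ?W (D \<otimes>\<^sub>o E) \<Zsemi> ((\<one> ?V \<oplus> \<one> ?W) \<oplus> h)) \<Zsemi> ((?n \<oplus> \<one> ?X) \<Zsemi> ?n')))"
    using ob arr by simp
  also have "((\<one> ?V \<oplus> g) \<otimes> \<one> E) \<Zsemi> \<partial>\<^sup>R ?V (?W \<oplus>\<^sub>o D) E = \<partial>\<^sup>R ?V B E \<Zsemi> (\<one> ?V \<oplus> (g \<otimes> \<one> E))"
    using ob arr by (simp add: target.rdist_natural)
  also have "a\<^sub>\<oplus> ?V ?W (D \<otimes>\<^sub>o E) \<Zsemi> ((\<one> ?V \<oplus> \<one> ?W) \<oplus> h) = (\<one> ?V \<oplus> (\<one> ?W \<oplus> h)) \<Zsemi> a\<^sub>\<oplus> ?V ?W ?X"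
    using ob arr by (subst target.par.assoc_natural) simp_all
  also have "\<dots> \<Zsemi> ((?n \<oplus> \<one> ?X) \<Zsemi> ?n')
      = (\<one> ?V \<oplus> (\<one> ?W \<oplus> h)) \<Zsemi> (a\<^sub>\<oplus> ?V ?W ?X \<Zsemi> ((?n \<oplus> \<one> ?X) \<Zsemi> ?n'))"
    using ob arr by simp
  also have "(f \<otimes> \<one> E) \<Zsemi> ((\<partial>\<^sup>R ?V B E \<Zsemi> (\<one> ?V \<oplus> (g \<otimes> \<one> E))) \<Zsemi> ((\<one> ?V \<oplus> \<partial>\<^sup>R ?W D E) \<Zsemi> \<dots>))
      = absorb B E (W \<oplus>\<^sub>o\<^bsub>U\<^esub> X) (absorb D E X h (g, W)) (f, V) \<Zsemi> on_arr M (a\<^sub>\<oplus>\<^bsub>U\<^esub> V W X)"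
    using ob arr unfolding n_par_assoc_inv[OF V W X] by (simp add: absorb_def)
  finally show ?thesis .
qed

lemma absorb_id:
  assumes X: "X \<in> Ob U" and A: "A \<in> Ob C" and E: "E \<in> Ob C"
    and h: "h \<in> hom C (A \<otimes>\<^sub>o E) (on_ob M X)"
  shows "absorb A E X h (kraus_id U C M A) = h \<Zsemi> on_arr M ((u\<^sup>L\<^sub>\<oplus>\<^bsub>U\<^esub> X)\<^sup>-\<^sup>1\<^bsub>U\<^esub>)"
proof -
  let ?X = "on_ob M X" and ?I = "on_ob M \<bottom>\<^bsub>U\<^esub>"
  let ?n = "(n_par M \<bottom>\<^bsub>U\<^esub> X)\<^sup>-\<^sup>1" and ?b = "(n_bot M)\<^sup>-\<^sup>1"
  note ob = X A E
  have arr: "h \<in> Arr C" "Dom C h = A \<otimes>\<^sub>o E" "Cod C h = ?X"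
    using h by (auto simp: hom_iff)
  have lunit: "((u\<^sup>L\<^sub>\<oplus> A)\<^sup>-\<^sup>1 \<otimes> \<one> E) \<Zsemi> \<partial>\<^sup>R \<bottom> A E = (u\<^sup>L\<^sub>\<oplus> (A \<otimes>\<^sub>o E))\<^sup>-\<^sup>1"
    by (rule target.tensor.iso_cancel_right[of "u\<^sup>L\<^sub>\<oplus> (A \<otimes>\<^sub>o E)"])
      (use A E in \<open>simp_all add: target.rdist_par_unit\<close>)
  have on_lunit: "(u\<^sup>L\<^sub>\<oplus> ?X)\<^sup>-\<^sup>1 \<Zsemi> ((?b \<oplus> \<one> ?X) \<Zsemi> ?n) = on_arr M ((u\<^sup>L\<^sub>\<oplus>\<^bsub>U\<^esub> X)\<^sup>-\<^sup>1\<^bsub>U\<^esub>)"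
    using X by (simp add: on_par_lunit_inv[symmetric])
  have "absorb A E X h (kraus_id U C M A)
      = ((u\<^sup>L\<^sub>\<oplus> A)\<^sup>-\<^sup>1 \<otimes> \<one> E) \<Zsemi> ((((?b \<oplus> \<one> A) \<otimes> \<one> E) \<Zsemi> \<partial>\<^sup>R ?I A E) \<Zsemi> ((\<one> ?I \<oplus> h) \<Zsemi> ?n))"
    using ob arr by (simp add: absorb_def kraus_id_def)
  also have "((?b \<oplus> \<one> A) \<otimes> \<one> E) \<Zsemi> \<partial>\<^sup>R ?I A E = \<partial>\<^sup>R \<bottom> A E \<Zsemi> (?b \<oplus> (\<one> A \<otimes> \<one> E))"
    using ob by (subst target.rdist_natural) simp_all
  also have "((u\<^sup>L\<^sub>\<oplus> A)\<^sup>-\<^sup>1 \<otimes> \<one> E) \<Zsemi> (\<dots> \<Zsemi> ((\<one> ?I \<oplus> h) \<Zsemi> ?n))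
      = (((u\<^sup>L\<^sub>\<oplus> A)\<^sup>-\<^sup>1 \<otimes> \<one> E) \<Zsemi> \<partial>\<^sup>R \<bottom> A E) \<Zsemi> ((\<one> \<bottom> \<oplus> h) \<Zsemi> ((?b \<oplus> \<one> ?X) \<Zsemi> ?n))"
    using ob arr by simp
  also have "\<dots> = ((u\<^sup>L\<^sub>\<oplus> (A \<otimes>\<^sub>o E))\<^sup>-\<^sup>1 \<Zsemi> (\<one> \<bottom> \<oplus> h)) \<Zsemi> ((?b \<oplus> \<one> ?X) \<Zsemi> ?n)"
    using ob arr unfolding lunit by simp
  also have "\<dots> = h \<Zsemi> ((u\<^sup>L\<^sub>\<oplus> ?X)\<^sup>-\<^sup>1 \<Zsemi> ((?b \<oplus> \<one> ?X) \<Zsemi> ?n))"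
    using ob arr by (simp add: target.par.lunit_inv_natural del: target.par.interchange target.par.interchange_prefix)
  finally show ?thesis
    unfolding on_lunit .
qed

section \<open>Composition of tests\<close>

lemma kraus_mapsE:
  assumes "p \<in> kraus_maps U C M A B"
  obtains f V where "p = (f, V)" "V \<in> Ob U" "f \<in> hom C A (on_ob M V \<oplus>\<^sub>o B)"
  using assms by (auto simp: kraus_maps_def)

lemma kraus_comp_maps:
  assumes "p \<in> kraus_maps U C M A B" "q \<in> kraus_maps U C M B D" "D \<in> Ob C"
  shows "kraus_comp U C M D p q \<in> kraus_maps U C M A D"
  using assms by (auto simp: kraus_maps_def kraus_comp_def hom_iff)

lemma kraus_id_maps: "A \<in> Ob C \<Longrightarrow> kraus_id U C M A \<in> kraus_maps U C M A A"
  by (simp add: kraus_maps_def kraus_id_def hom_iff)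

lemma absorb_maps:
  assumes "q \<in> kraus_maps U C M B D" "D \<in> Ob C" "E \<in> Ob C" "X \<in> Ob U" "h \<in> hom C (D \<otimes>\<^sub>o E) (on_ob M X)"
  shows "absorb D E X h q \<in> hom C (B \<otimes>\<^sub>o E) (on_ob M (snd q \<oplus>\<^sub>o\<^bsub>U\<^esub> X))"
  using assms absorb_hom by (auto elim!: kraus_mapsE)

lemma kraus_test_surround:
  assumes "p \<in> kraus_maps U C M A B" "B \<in> Ob C" "E \<in> Ob C" "X \<in> Ob U"
    and "h \<in> hom C (B \<otimes>\<^sub>o E) (on_ob M X)"
  shows "kraus_test U C M A B E X h p = surround B E (square X h) p"
  using assms kraus_test_eq_surround by (auto elim!: kraus_mapsE)

lemma kraus_test_square:
  assumes "p \<in> kraus_maps U C M A B" "B \<in> Ob C" "E \<in> Ob C" "X \<in> Ob U"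
    and "h \<in> hom C (B \<otimes>\<^sub>o E) (on_ob M X)"
  shows "kraus_test U C M A B E X h p = square (snd p \<oplus>\<^sub>o\<^bsub>U\<^esub> X) (absorb B E X h p)"
  using assms kraus_test_eq_square by (auto elim!: kraus_mapsE)

text \<open>
  The right-hand side mentions the first Kraus map only through one of its tests.
\<close>

lemma kraus_test_comp:
  assumes p: "p \<in> kraus_maps U C M A B" and q: "q \<in> kraus_maps U C M B D"
    and B: "B \<in> Ob C" and D: "D \<in> Ob C" and E: "E \<in> Ob C"
    and X: "X \<in> Ob U" and h: "h \<in> hom C (D \<otimes>\<^sub>o E) (on_ob M X)"
  shows "kraus_test U C M A D E X h (kraus_comp U C M D p q)
      = kraus_test U C M A B E (snd q \<oplus>\<^sub>o\<^bsub>U\<^esub> X) (absorb D E X h q) p"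
proof -
  obtain f V where pf: "p = (f, V)" and V: "V \<in> Ob U" and f: "f \<in> hom C A (on_ob M V \<oplus>\<^sub>o B)"
    using p by (rule kraus_mapsE)
  obtain g W where qg: "q = (g, W)" and W: "W \<in> Ob U" and g: "g \<in> hom C B (on_ob M W \<oplus>\<^sub>o D)"
    using q by (rule kraus_mapsE)
  note pq = kraus_comp_maps[OF p q D] and ah = absorb_maps[OF q D E X h]
  let ?k = "absorb B E (W \<oplus>\<^sub>o\<^bsub>U\<^esub> X) (absorb D E X h q) p"
  have k: "?k \<in> Arr C" "Cod C ?k = on_ob M (V \<oplus>\<^sub>o\<^bsub>U\<^esub> (W \<oplus>\<^sub>o\<^bsub>U\<^esub> X))"
    using absorb_maps[OF p B E _ ah] W X by (auto simp: hom_iff pf qg)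
  have "kraus_test U C M A D E X h (kraus_comp U C M D p q)
      = square ((V \<oplus>\<^sub>o\<^bsub>U\<^esub> W) \<oplus>\<^sub>o\<^bsub>U\<^esub> X) (absorb D E X h (kraus_comp U C M D p q))"
    using kraus_test_square[OF pq D E X h] by (simp add: pf qg kraus_comp_def)
  also have "\<dots> = square ((V \<oplus>\<^sub>o\<^bsub>U\<^esub> W) \<oplus>\<^sub>o\<^bsub>U\<^esub> X) (?k \<Zsemi> on_arr M (a\<^sub>\<oplus>\<^bsub>U\<^esub> V W X))"
    using absorb_comp[OF V W X B D E f g h] by (simp add: pf qg)
  also have "\<dots> = square (V \<oplus>\<^sub>o\<^bsub>U\<^esub> (W \<oplus>\<^sub>o\<^bsub>U\<^esub> X)) ?k"
    using V W X k source.par_assoc_unitary[OF V W X] by (intro square_unitary) simp_all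
  also have "\<dots> = kraus_test U C M A B E (snd q \<oplus>\<^sub>o\<^bsub>U\<^esub> X) (absorb D E X h q) p"
    using kraus_test_square[OF p B E _ ah] W X by (simp add: pf qg)
  finally show ?thesis .
qed

text \<open>
  The right-hand side mentions the second Kraus map only through its test against the same effect.
\<close>

lemma kraus_test_comp_surround:
  assumes p: "p \<in> kraus_maps U C M A B" and q: "q \<in> kraus_maps U C M B D"
    and B: "B \<in> Ob C" and D: "D \<in> Ob C" and E: "E \<in> Ob C"
    and X: "X \<in> Ob U" and h: "h \<in> hom C (D \<otimes>\<^sub>o E) (on_ob M X)"
  shows "kraus_test U C M A D E X h (kraus_comp U C M D p q)
      = surround B E (kraus_test U C M B D E X h q) p"
proof -
  have "snd q \<in> Ob U" using q by (auto elim: kraus_mapsE)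
  then show ?thesis
    using kraus_test_surround[OF p B E _ absorb_maps[OF q D E X h]] X
    unfolding kraus_test_comp[OF assms] kraus_test_square[OF q D E X h] by simp
qed

lemma kraus_test_id:
  assumes A: "A \<in> Ob C" and E: "E \<in> Ob C" and X: "X \<in> Ob U" and h: "h \<in> hom C (A \<otimes>\<^sub>o E) (on_ob M X)"
  shows "kraus_test U C M A A E X h (kraus_id U C M A) = square X h"
proof -
  have "kraus_test U C M A A E X h (kraus_id U C M A)
      = square (\<bottom>\<^bsub>U\<^esub> \<oplus>\<^sub>o\<^bsub>U\<^esub> X) (h \<Zsemi> on_arr M ((u\<^sup>L\<^sub>\<oplus>\<^bsub>U\<^esub> X)\<^sup>-\<^sup>1\<^bsub>U\<^esub>))"
    using kraus_test_square[OF kraus_id_maps A E X h] A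
    unfolding absorb_id[OF X A E h] by (simp add: kraus_id_def)
  also have "\<dots> = square X h"
    using X h source.par_lunit_inv_unitary[OF X] by (intro square_unitary) (simp_all add: hom_iff)
  finally show ?thesis .
qed

section \<open>Kraus maps up to equivalence\<close>

lemma kraus_equivI:
  assumes "p \<in> kraus_maps U C M A B" "q \<in> kraus_maps U C M A B"
    and "\<And>E X h. \<lbrakk>E \<in> Ob C; X \<in> Ob U; h \<in> hom C (B \<otimes>\<^sub>o E) (on_ob M X)\<rbrakk>
      \<Longrightarrow> kraus_test U C M A B E X h p = kraus_test U C M A B E X h q"
  shows "(p, q) \<in> kraus_equiv U C M A B"
  using assms by (simp add: kraus_equiv_def)

lemma kraus_equivD:
  assumes "(p, q) \<in> kraus_equiv U C M A B"
  shows "p \<in> kraus_maps U C M A B" "q \<in> kraus_maps U C M A B"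
    and "\<lbrakk>E \<in> Ob C; X \<in> Ob U; h \<in> hom C (B \<otimes>\<^sub>o E) (on_ob M X)\<rbrakk>
      \<Longrightarrow> kraus_test U C M A B E X h p = kraus_test U C M A B E X h q"
  using assms by (simp_all add: kraus_equiv_def)

lemma equiv_kraus_equiv: "equiv (kraus_maps U C M A B) (kraus_equiv U C M A B)"
  by (rule equivI) (auto simp: kraus_equiv_def refl_on_def sym_def trans_def)

text \<open>
  The first factor is exchanged with the test of a composite written as a test of that factor,
  the second with the test written as a surrounded test.
\<close>

lemma kraus_comp_respects:
  assumes pp': "(p, p') \<in> kraus_equiv U C M A B" and qq': "(q, q') \<in> kraus_equiv U C M B D"
    and B: "B \<in> Ob C" and D: "D \<in> Ob C"
  shows "(kraus_comp U C M D p q, kraus_comp U C M D p' q') \<in> kraus_equiv U C M A D"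
proof (rule kraus_equivI)
  note p = kraus_equivD(1,2)[OF pp'] and q = kraus_equivD(1,2)[OF qq']
  show "kraus_comp U C M D p q \<in> kraus_maps U C M A D" "kraus_comp U C M D p' q' \<in> kraus_maps U C M A D"
    using kraus_comp_maps p q D by blast+
  fix E X h assume E: "E \<in> Ob C" and X: "X \<in> Ob U" and h: "h \<in> hom C (D \<otimes>\<^sub>o E) (on_ob M X)"
  have "snd q \<in> Ob U" using q(1) by (auto elim: kraus_mapsE)
  then have "kraus_test U C M A D E X h (kraus_comp U C M D p q)
      = kraus_test U C M A D E X h (kraus_comp U C M D p' q)"
    using kraus_equivD(3)[OF pp' E _ absorb_maps[OF q(1) D E X h]] X
    by (simp add: kraus_test_comp[OF p(1) q(1) B D E X h] kraus_test_comp[OF p(2) q(1) B D E X h])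
  also have "\<dots> = kraus_test U C M A D E X h (kraus_comp U C M D p' q')"
    using kraus_equivD(3)[OF qq' E X h]
    by (simp add: kraus_test_comp_surround[OF p(2) q(1) B D E X h] kraus_test_comp_surround[OF p(2) q(2) B D E X h])
  finally show "kraus_test U C M A D E X h (kraus_comp U C M D p q)
      = kraus_test U C M A D E X h (kraus_comp U C M D p' q')" .
qed

lemma kraus_comp_id_left:
  assumes p: "p \<in> kraus_maps U C M A B" and A: "A \<in> Ob C" and B: "B \<in> Ob C"
  shows "(kraus_comp U C M B (kraus_id U C M A) p, p) \<in> kraus_equiv U C M A B"
proof (rule kraus_equivI)
  show "kraus_comp U C M B (kraus_id U C M A) p \<in> kraus_maps U C M A B" "p \<in> kraus_maps U C M A B"
    using kraus_comp_maps kraus_id_maps p A B by blast+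
  fix E X h assume E: "E \<in> Ob C" and X: "X \<in> Ob U" and h: "h \<in> hom C (B \<otimes>\<^sub>o E) (on_ob M X)"
  have "snd p \<oplus>\<^sub>o\<^bsub>U\<^esub> X \<in> Ob U" using p X by (auto elim: kraus_mapsE)
  then show "kraus_test U C M A B E X h (kraus_comp U C M B (kraus_id U C M A) p) = kraus_test U C M A B E X h p"
    unfolding kraus_test_comp[OF kraus_id_maps[OF A] p A B E X h] kraus_test_square[OF p B E X h]
    using kraus_test_id[OF A E _ absorb_maps[OF p B E X h]] by simp
qed

lemma kraus_comp_id_right:
  assumes p: "p \<in> kraus_maps U C M A B" and A: "A \<in> Ob C" and B: "B \<in> Ob C"
  shows "(kraus_comp U C M B p (kraus_id U C M B), p) \<in> kraus_equiv U C M A B"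
proof (rule kraus_equivI)
  show "kraus_comp U C M B p (kraus_id U C M B) \<in> kraus_maps U C M A B" "p \<in> kraus_maps U C M A B"
    using kraus_comp_maps kraus_id_maps p A B by blast+
  fix E X h assume E: "E \<in> Ob C" and X: "X \<in> Ob U" and h: "h \<in> hom C (B \<otimes>\<^sub>o E) (on_ob M X)"
  show "kraus_test U C M A B E X h (kraus_comp U C M B p (kraus_id U C M B)) = kraus_test U C M A B E X h p"
    unfolding kraus_test_comp_surround[OF p kraus_id_maps[OF B] B B E X h]
      kraus_test_id[OF B E X h] kraus_test_surround[OF p B E X h] ..
qed

text \<open>
  Let the third factor absorb the effect. Both composites are then tested by surrounding, with the
  first factor, the test of the second factor against the resulting effect.
\<close>

lemma kraus_comp_assoc:
  assumes p: "p \<in> kraus_maps U C M A B" and q: "q \<in> kraus_maps U C M B D" and r: "r \<in> kraus_maps U C M D G"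
    and B: "B \<in> Ob C" and D: "D \<in> Ob C" and G: "G \<in> Ob C"
  shows "(kraus_comp U C M G (kraus_comp U C M D p q) r, kraus_comp U C M G p (kraus_comp U C M G q r))
    \<in> kraus_equiv U C M A G"
proof (rule kraus_equivI)
  note pq = kraus_comp_maps[OF p q D] and qr = kraus_comp_maps[OF q r G]
  show "kraus_comp U C M G (kraus_comp U C M D p q) r \<in> kraus_maps U C M A G"
      "kraus_comp U C M G p (kraus_comp U C M G q r) \<in> kraus_maps U C M A G"
    using kraus_comp_maps pq qr p r G by blast+
  fix E X h assume E: "E \<in> Ob C" and X: "X \<in> Ob U" and h: "h \<in> hom C (G \<otimes>\<^sub>o E) (on_ob M X)"
  note h_r = absorb_maps[OF r G E X h]
  have rX: "snd r \<oplus>\<^sub>o\<^bsub>U\<^esub> X \<in> Ob U" using r X by (auto elim: kraus_mapsE)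
  show "kraus_test U C M A G E X h (kraus_comp U C M G (kraus_comp U C M D p q) r)
      = kraus_test U C M A G E X h (kraus_comp U C M G p (kraus_comp U C M G q r))"
    unfolding kraus_test_comp[OF pq r D G E X h] kraus_test_comp_surround[OF p q B D E rX h_r]
      kraus_test_comp_surround[OF p qr B G E X h] kraus_test_comp[OF q r D G E X h] ..
qed

abbreviation kraus_class :: "'co \<Rightarrow> 'co \<Rightarrow> 'cm \<times> 'uo \<Rightarrow> 'co \<times> ('cm \<times> 'uo) set \<times> 'co" where
  "kraus_class A B p \<equiv> (A, kraus_equiv U C M A B `` {p}, B)"

lemma kraus_class_eqI:
  "(p, q) \<in> kraus_equiv U C M A B \<Longrightarrow> kraus_class A B p = kraus_class A B q"
  using equiv_class_eq[OF equiv_kraus_equiv] by simp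

lemma hom_CP_inftyE:
  assumes "x \<in> hom (CP_infty U C M) A B"
  obtains p where "x = kraus_class A B p" "p \<in> kraus_maps U C M A B" "A \<in> Ob C" "B \<in> Ob C"
  using assms by (auto simp: hom_def CP_infty_def elim!: quotientE)

lemma kraus_class_hom:
  assumes "p \<in> kraus_maps U C M A B" "A \<in> Ob C" "B \<in> Ob C"
  shows "kraus_class A B p \<in> hom (CP_infty U C M) A B"
  using assms by (auto simp: hom_def CP_infty_def intro: quotientI)

lemma cmp_kraus_class:
  assumes p: "p \<in> kraus_maps U C M A B" and q: "q \<in> kraus_maps U C M B D"
    and B: "B \<in> Ob C" and D: "D \<in> Ob C"
  shows "kraus_class A B p \<Zsemi>\<^bsub>CP_infty U C M\<^esub> kraus_class B D q = kraus_class A D (kraus_comp U C M D p q)"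
proof -
  have "kraus_equiv U C M A D `` {kraus_comp U C M D p' q'} = kraus_equiv U C M A D `` {kraus_comp U C M D p q}"
    if "p' \<in> kraus_equiv U C M A B `` {p}" "q' \<in> kraus_equiv U C M B D `` {q}" for p' q'
    using that kraus_comp_respects[of p p' A B q q' D] B D equiv_class_eq[OF equiv_kraus_equiv] by blast
  moreover have "p \<in> kraus_equiv U C M A B `` {p}" "q \<in> kraus_equiv U C M B D `` {q}"
    using p q equiv_class_self[OF equiv_kraus_equiv] by blast+
  ultimately have "(\<Union>p' \<in> kraus_equiv U C M A B `` {p}. \<Union>q' \<in> kraus_equiv U C M B D `` {q}.
      kraus_equiv U C M A D `` {kraus_comp U C M D p' q'}) = kraus_equiv U C M A D `` {kraus_comp U C M D p q}"
    by blast
  then show ?thesis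
    by (simp add: CP_infty_def)
qed

end

theorem proposition5p9:
  fixes U :: "('uo, 'um) unitary_category"
    and C :: "('co, 'cm) dagger_isomix"
    and M :: "('uo, 'um, 'co, 'cm) dagger_isomix_functor"
  assumes "mixed_unitary_category U C M"
  shows "category (CP_infty U C M)"
proof -
  interpret mixed_unitary_category U C M by (rule assms)
  let ?K = "CP_infty U C M"
  have ide: "ide ?K A = kraus_class A A (kraus_id U C M A)" for A
    by (simp add: CP_infty_def)
  show ?thesis
  proof
    show "Dom ?K x \<in> Ob ?K" "Cod ?K x \<in> Ob ?K" if "x \<in> Arr ?K" for x
      using that by (auto simp: CP_infty_def)
    show "ide ?K A \<in> hom ?K A A" if "A \<in> Ob ?K" for A
      using that kraus_class_hom kraus_id_maps by (simp add: ide CP_infty_def)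
    fix A B x assume "x \<in> hom ?K A B"
    then obtain p where x: "x = kraus_class A B p" and p: "p \<in> kraus_maps U C M A B"
      and A: "A \<in> Ob C" and B: "B \<in> Ob C" by (rule hom_CP_inftyE)
    show "cmp ?K (ide ?K A) x = x"
      unfolding x ide cmp_kraus_class[OF kraus_id_maps[OF A] p A B]
      by (rule kraus_class_eqI) (rule kraus_comp_id_left[OF p A B])
    show "cmp ?K x (ide ?K B) = x"
      unfolding x ide cmp_kraus_class[OF p kraus_id_maps[OF B] B B]
      by (rule kraus_class_eqI) (rule kraus_comp_id_right[OF p A B])
    fix D y assume "y \<in> hom ?K B D"
    then obtain q where y: "y = kraus_class B D q" and q: "q \<in> kraus_maps U C M B D"
      and D: "D \<in> Ob C" by (rule hom_CP_inftyE)
    note pq = kraus_comp_maps[OF p q D]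
    show "cmp ?K x y \<in> hom ?K A D"
      unfolding x y cmp_kraus_class[OF p q B D] using kraus_class_hom pq A D by simp
    fix G z assume "z \<in> hom ?K D G"
    then obtain r where z: "z = kraus_class D G r" and r: "r \<in> kraus_maps U C M D G"
      and G: "G \<in> Ob C" by (rule hom_CP_inftyE)
    show "cmp ?K (cmp ?K x y) z = cmp ?K x (cmp ?K y z)"
      unfolding x y z cmp_kraus_class[OF p q B D] cmp_kraus_class[OF pq r D G]
        cmp_kraus_class[OF q r D G] cmp_kraus_class[OF p kraus_comp_maps[OF q r G] B G]
      by (rule kraus_class_eqI) (rule kraus_comp_assoc[OF p q r B D G])
  qed
qed

end
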